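(* Let $\Sigma\subset\mathbb{R}^2\times\mathbb{R}^2$ be a measurable set such that $0<m(\Sigma)<1$, where $m$ is Lebesgue measure, and let $\Sigma^c$ be its complement in $\mathbb{R}^2\times\mathbb{R}^2$. Then for all $f,\varphi\in L^2(\mathbb{R}^2,\mathbb{H})$, $$\|f\|_{L^2(\mathbb{R}^2,\mathbb{H})}\,\|\varphi\|_{L^2(\mathbb{R}^2,\mathbb{H})}\ \leq\ \frac{1}{\sqrt{1-m(\Sigma)}}\left(\int\int_{\Sigma^{c}}|\mathcal{G}_{\varphi}\{f\}(\omega,b)|^2\,d\omega\,db\right)^{\frac12}.$$
   Context: $\mathbb{H}$ is the algebra of real quaternions with imaginary units $i,j,k$ ($i^2=j^2=k^2=ijk=-1$), conjugation $\overline{q}$ and modulus $|q|=\sqrt{q\overline{q}}$. $L^2(\mathbb{R}^2,\mathbb{H})$ is the space of measurable $f:\mathbb{R}^2\to\mathbb{H}$ with $\|f\|_{L^2(\mathbb{R}^2,\mathbb{H})}=\left(\int_{\mathbb{R}^2}|f(x)|^2dx\right)^{1/2}<\infty$. For $f,\varphi\in L^2(\mathbb{R}^2,\mathbb{H})$, the two-sided Gabor quaternion Fourier transform (GQFT) of $f$ with window $\varphi$ is $$\mathcal{G}_{\varphi}\{f\}(\omega,b)=\int_{\mathbb{R}^2}e^{-2\pi i x_1\omega_1}\,f(x)\,\overline{\varphi(x-b)}\,e^{-2\pi j x_2\omega_2}\,dx,\qquad \omega=(\omega_1,\omega_2),\ b\in\mathbb{R}^2.$$ *)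

theory Defs
  imports "HOL-Analysis.Analysis"
begin

section \<open>The algebra of real quaternions\<close>

codatatype quat = Quat (qRe: real) (qI: real) (qJ: real) (qK: real)

lemma quat_eqI:
  "qRe p = qRe q \<Longrightarrow> qI p = qI q \<Longrightarrow> qJ p = qJ q \<Longrightarrow> qK p = qK q \<Longrightarrow> p = q"
  by (rule quat.expand) simp

lemma quat_eq_iff:
  "p = q \<longleftrightarrow> qRe p = qRe q \<and> qI p = qI q \<and> qJ p = qJ q \<and> qK p = qK q"
  by (auto intro: quat_eqI)

instantiation quat :: ring_1
begin

primcorec zero_quat where
  "qRe 0 = 0" | "qI 0 = 0" | "qJ 0 = 0" | "qK 0 = 0"

primcorec one_quat where
  "qRe 1 = 1" | "qI 1 = 0" | "qJ 1 = 0" | "qK 1 = 0"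

primcorec plus_quat where
  "qRe (p + q) = qRe p + qRe q"
| "qI (p + q) = qI p + qI q"
| "qJ (p + q) = qJ p + qJ q"
| "qK (p + q) = qK p + qK q"

primcorec uminus_quat where
  "qRe (- q) = - qRe q" | "qI (- q) = - qI q" | "qJ (- q) = - qJ q" | "qK (- q) = - qK q"

primcorec minus_quat where
  "qRe (p - q) = qRe p - qRe q"
| "qI (p - q) = qI p - qI q"
| "qJ (p - q) = qJ p - qJ q"
| "qK (p - q) = qK p - qK q"

primcorec times_quat where
  "qRe (p * q) = qRe p * qRe q - qI p * qI q - qJ p * qJ q - qK p * qK q"
| "qI (p * q) = qRe p * qI q + qI p * qRe q + qJ p * qK q - qK p * qJ q"
| "qJ (p * q) = qRe p * qJ q - qI p * qK q + qJ p * qRe q + qK p * qI q"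
| "qK (p * q) = qRe p * qK q + qI p * qJ q - qJ p * qI q + qK p * qRe q"

instance
  by standard (simp_all add: quat_eq_iff algebra_simps)

end

primcorec quat_i :: quat where
  "qRe quat_i = 0" | "qI quat_i = 1" | "qJ quat_i = 0" | "qK quat_i = 0"

primcorec quat_j :: quat where
  "qRe quat_j = 0" | "qI quat_j = 0" | "qJ quat_j = 1" | "qK quat_j = 0"

primcorec quat_k :: quat where
  "qRe quat_k = 0" | "qI quat_k = 0" | "qJ quat_k = 0" | "qK quat_k = 1"

primcorec qcnj :: "quat \<Rightarrow> quat" where
  "qRe (qcnj q) = qRe q"
| "qI (qcnj q) = - qI q"
| "qJ (qcnj q) = - qJ q"
| "qK (qcnj q) = - qK q"

lemma quat_units:
  "quat_i * quat_i = -1" "quat_j * quat_j = -1" "quat_k * quat_k = -1"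
  "quat_i * quat_j * quat_k = -1"
  by (simp_all add: quat_eq_iff)

instantiation quat :: real_vector
begin

primcorec scaleR_quat where
  "qRe (r *\<^sub>R q) = r * qRe q"
| "qI (r *\<^sub>R q) = r * qI q"
| "qJ (r *\<^sub>R q) = r * qJ q"
| "qK (r *\<^sub>R q) = r * qK q"

instance
  by standard (simp_all add: quat_eq_iff algebra_simps)

end

instantiation quat :: real_inner
begin

definition inner_quat_def:
  "p \<bullet> q = qRe p * qRe q + qI p * qI q + qJ p * qJ q + qK p * qK q"

definition norm_quat_def: "norm (q::quat) = sqrt (q \<bullet> q)"

definition sgn_quat_def: "sgn (q::quat) = q /\<^sub>R norm q"

definition dist_quat_def: "dist (p::quat) q = norm (p - q)"

definition uniformity_quat_def:
  "(uniformity :: (quat \<times> quat) filter) = (INF e\<in>{0<..}. principal {(x, y). dist x y < e})"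

definition open_quat_def:
  "open (U :: quat set) \<longleftrightarrow>
    (\<forall>x\<in>U. eventually (\<lambda>(x', y). x' = x \<longrightarrow> y \<in> U) uniformity)"

instance
proof
  fix p q s :: quat and r :: real
  show "sgn p = p /\<^sub>R norm p" by (rule sgn_quat_def)
  show "dist p q = norm (p - q)" by (rule dist_quat_def)
  show "p \<bullet> q = q \<bullet> p" "(p + q) \<bullet> s = p \<bullet> s + q \<bullet> s" "(r *\<^sub>R p) \<bullet> q = r * (p \<bullet> q)" "0 \<le> p \<bullet> p"
    by (simp_all add: inner_quat_def algebra_simps)
  show "p \<bullet> p = 0 \<longleftrightarrow> p = 0"
    by (auto simp: inner_quat_def quat_eq_iff add_nonneg_eq_0_iff)
  show "norm p = sqrt (p \<bullet> p)" by (rule norm_quat_def)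
qed (rule uniformity_quat_def open_quat_def)+

end

lemma quat_norm_sq: "(norm (q::quat))\<^sup>2 = (qRe q)\<^sup>2 + (qI q)\<^sup>2 + (qJ q)\<^sup>2 + (qK q)\<^sup>2"
  unfolding power2_norm_eq_inner inner_quat_def by (simp add: power2_eq_square)

instantiation quat :: real_normed_div_algebra
begin

definition inverse_quat_def: "inverse (q::quat) = qcnj q /\<^sub>R (norm q)\<^sup>2"

definition divide_quat_def: "(p::quat) div q = p * inverse q"

instance
proof
  fix p q :: quat and r :: real
  show "r *\<^sub>R p * q = r *\<^sub>R (p * q)" "p * r *\<^sub>R q = r *\<^sub>R (p * q)"
    by (simp_all add: quat_eq_iff algebra_simps)
  show "inverse p * p = 1" "p * inverse p = 1" if "p \<noteq> 0"
  proof -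
    define n where "n = (norm p)\<^sup>2"
    have n: "n \<noteq> 0" using that by (simp add: n_def)
    have *: "qcnj p * p = n *\<^sub>R 1" "p * qcnj p = n *\<^sub>R 1"
      unfolding n_def quat_norm_sq by (simp_all add: quat_eq_iff power2_eq_square)
    have "inverse p * p = (1 / n) *\<^sub>R (qcnj p * p)" "p * inverse p = (1 / n) *\<^sub>R (p * qcnj p)"
      by (simp_all add: inverse_quat_def n_def[symmetric] quat_eq_iff divide_inverse algebra_simps)
    then show "inverse p * p = 1" "p * inverse p = 1"
      using n by (simp_all add: *)
  qed
  show "p div q = p * inverse q" by (rule divide_quat_def)
  show "inverse (0::quat) = 0" by (simp add: inverse_quat_def)
  have "(norm (p * q))\<^sup>2 = (norm p * norm q)\<^sup>2"
    unfolding power_mult_distrib quat_norm_sq times_quat.sel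
    by (simp add: power2_eq_square algebra_simps)
  then show "norm (p * q) = norm p * norm q"
    by (rule power2_eq_imp_eq) simp_all
qed

end

instantiation quat :: euclidean_space
begin

definition Basis_quat_def: "Basis = {1, quat_i, quat_j, quat_k}"

instance
proof
  have units: "(1::quat) \<noteq> quat_i" "(1::quat) \<noteq> quat_j" "(1::quat) \<noteq> quat_k"
    "quat_i \<noteq> quat_j" "quat_i \<noteq> quat_k" "quat_j \<noteq> quat_k"
    by (simp_all add: quat_eq_iff)
  show "(Basis :: quat set) \<noteq> {}" "finite (Basis :: quat set)"
    by (simp_all add: Basis_quat_def)
  show "u \<bullet> v = (if u = v then 1 else 0)" if "u \<in> Basis" "v \<in> Basis" for u v :: quat
  proof -
    from that have "u = 1 \<or> u = quat_i \<or> u = quat_j \<or> u = quat_k"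
      "v = 1 \<or> v = quat_i \<or> v = quat_j \<or> v = quat_k"
      by (simp_all add: Basis_quat_def)
    then show ?thesis
      by (elim disjE) (simp_all add: inner_quat_def units units[symmetric])
  qed
  show "(\<forall>u\<in>Basis. x \<bullet> u = 0) \<longleftrightarrow> x = 0" for x :: quat
    unfolding quat_eq_iff[of x] by (simp add: Basis_quat_def inner_quat_def)
qed

end

lemma quat_mult_cnj: "q * qcnj q = of_real ((norm q)\<^sup>2)"
  unfolding of_real_def quat_norm_sq by (simp add: quat_eq_iff power2_eq_square)


section \<open>Square-integrable functions and the Gabor quaternion Fourier transform\<close>

text \<open>The plane is the Euclidean space \<^typ>\<open>real \<times> real\<close>, with the coordinates
  \<open>x\<^sub>1 = fst x\<close> and \<open>x\<^sub>2 = snd x\<close>. Measurability is Lebesgue measurability.\<close>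

definition L2_quat :: "((real \<times> real) \<Rightarrow> quat) set" where
  "L2_quat = {f. f \<in> borel_measurable lebesgue \<and> integrable lebesgue (\<lambda>x. (norm (f x))\<^sup>2)}"

definition L2_norm_quat :: "((real \<times> real) \<Rightarrow> quat) \<Rightarrow> real" where
  "L2_norm_quat f = sqrt (LINT x|lebesgue. (norm (f x))\<^sup>2)"

text \<open>The exponential is the power series \<^const>\<open>exp\<close> in the Banach algebra of quaternions; as
  multiplication is not commutative, the order of the four factors matters.\<close>

definition GQFT ::
  "((real \<times> real) \<Rightarrow> quat) \<Rightarrow> ((real \<times> real) \<Rightarrow> quat) \<Rightarrow> real \<times> real \<Rightarrow> real \<times> real \<Rightarrow> quat" where
  "GQFT \<phi> f \<omega> b =
    (LINT x|lebesgue.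
      exp ((- (2 * pi * fst x * fst \<omega>)) *\<^sub>R quat_i) * f x * qcnj (\<phi> (x - b)) *
      exp ((- (2 * pi * snd x * snd \<omega>)) *\<^sub>R quat_j))"

end

theory Submission
  imports Defs "HOL-Probability.Characteristic_Functions"
begin

text \<open>The Gabor transform satisfies the Plancherel identity
  \<open>\<integral>\<integral> |G f(\<omega>, b)|\<^sup>2 d\<omega> db = C\<close> with \<open>C = \<parallel>f\<parallel>\<^sup>2 \<parallel>\<phi>\<parallel>\<^sup>2\<close>, and by Cauchy-Schwarz \<open>|G f|\<^sup>2 \<le> C\<close> pointwise,
  so \<open>\<Sigma>\<close> carries at most \<open>m(\<Sigma>) C\<close> and its complement at least \<open>(1 - m(\<Sigma>)) C\<close>.

  By Tonelli, the Plancherel identity reduces to the one for the two-sided quaternion Fourier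
  transform of \<open>h = f(\<cdot>) \<phi>(\<cdot> - b)\<^sup>*\<close>, which lies in \<open>L\<^sup>1\<close> for every \<open>b\<close> and in \<open>L\<^sup>2\<close> for almost every \<open>b\<close>.
  For this one, integrate \<open>|F h|\<^sup>2\<close> against Gaussian weights increasing to 1. The weights are even in
  each coordinate, so the non-commuting sine terms cancel and the integral equals that of the
  autocorrelation of \<open>h\<close> against a Gaussian approximate identity; it converges to \<open>\<parallel>h\<parallel>\<^sup>2\<close> because
  translation is continuous in \<open>L\<^sup>2\<close>.\<close>

subsection \<open>Continuity of translation in the mean\<close>

lemma distr_lborel_shift: "distr lborel lborel (\<lambda>x. x + u) = (lborel :: 'a::euclidean_space measure)"
  using lborel_distr_plus[of u] by (simp add: add.commute cong: distr_cong)

lemma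
  fixes g :: "'a::euclidean_space \<Rightarrow> 'b::{banach, second_countable_topology}"
  shows integrable_lborel_shift: "integrable lborel g \<Longrightarrow> integrable lborel (\<lambda>x. g (x + u))"
    and integral_lborel_shift: "(LINT x|lborel. g (x + u)) = (LINT x|lborel. g x)"
proof -
  note * = distr_lborel_shift[of u]
  show "integrable lborel (\<lambda>x. g (x + u))" if "integrable lborel g"
    by (rule integrable_distr[of _ _ lborel]) (use that in \<open>simp_all add: *\<close>)
  show "(LINT x|lborel. g (x + u)) = (LINT x|lborel. g x)"
  proof (cases "g \<in> borel_measurable borel")
    case True
    then show ?thesis
      by (subst (2) *[symmetric], subst integral_distr) auto
  next
    case False
    \<comment> \<open>Shifting back by \<open>u\<close> shows that the translate of a non-measurable
      function is non-measurable, so both integrals take the default value 0.\<close>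
    have "(\<lambda>x. g (x + u)) \<notin> borel_measurable borel"
    proof
      assume [measurable]: "(\<lambda>x. g (x + u)) \<in> borel_measurable borel"
      have "(\<lambda>x. (\<lambda>x. g (x + u)) (x - u)) \<in> borel_measurable borel"
        by measurable
      with False show False by simp
    qed
    with False have "\<not> integrable lborel g" "\<not> integrable lborel (\<lambda>x. g (x + u))"
      by (auto dest: borel_measurable_integrable)
    then show ?thesis by (simp add: not_integrable_integral_eq)
  qed
qed

text \<open>A three-term estimate: the approximation errors at \<open>x + u n\<close> and at
  \<open>x\<close> have the same integral because \<open>lborel\<close> is translation invariant.
  This serves twice in the induction for \<open>translation_L1\<close>: to replace a measurable set
  by an open one, and to pass to limits.\<close>

lemma translation_L1_approx:
  fixes g :: "'a::euclidean_space \<Rightarrow> 'b::{banach, second_countable_topology}"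
  assumes g: "integrable lborel g"
    and approx: "\<And>e. e > 0 \<Longrightarrow> \<exists>g'. integrable lborel g' \<and> (LINT x|lborel. norm (g x - g' x)) \<le> e \<and>
      (\<lambda>n. LINT x|lborel. norm (g' (x + u n) - g' x)) \<longlonglongrightarrow> 0"
  shows "(\<lambda>n. LINT x|lborel. norm (g (x + u n) - g x)) \<longlonglongrightarrow> 0"
proof (rule LIMSEQ_I)
  fix r :: real assume "r > 0"
  then obtain g' where g': "integrable lborel g'" "(LINT x|lborel. norm (g x - g' x)) \<le> r / 4"
    and lim: "(\<lambda>n. LINT x|lborel. norm (g' (x + u n) - g' x)) \<longlonglongrightarrow> 0"
    using approx[of "r / 4"] by auto
  have *: "(LINT x|lborel. norm (g (x + v) - g x))
      \<le> (LINT x|lborel. norm (g' (x + v) - g' x)) + r / 2" for v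
  proof -
    have "(LINT x|lborel. norm (g (x + v) - g x))
        \<le> (LINT x|lborel. norm (g (x + v) - g' (x + v)) + norm (g' (x + v) - g' x) + norm (g x - g' x))"
    proof (rule integral_mono)
      show "norm (g (x + v) - g x) \<le> norm (g (x + v) - g' (x + v)) + norm (g' (x + v) - g' x) + norm (g x - g' x)" for x
        by norm
    qed (intro Bochner_Integration.integrable_add integrable_norm Bochner_Integration.integrable_diff
        integrable_lborel_shift g g'(1))+
    also have "\<dots> = (LINT x|lborel. norm (g (x + v) - g' (x + v))) + (LINT x|lborel. norm (g' (x + v) - g' x))
        + (LINT x|lborel. norm (g x - g' x))"
      by (simp add: g g'(1) integrable_lborel_shift)
    also have "(LINT x|lborel. norm (g (x + v) - g' (x + v))) = (LINT x|lborel. norm (g x - g' x))"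
      by (rule integral_lborel_shift)
    finally show ?thesis using g'(2) by simp
  qed
  obtain N where N: "\<And>n. n \<ge> N \<Longrightarrow> norm ((LINT x|lborel. norm (g' (x + u n) - g' x)) - 0) < r / 2"
    using LIMSEQ_D[OF lim, of "r / 2"] \<open>r > 0\<close> by auto
  show "\<exists>no. \<forall>n\<ge>no. norm ((LINT x|lborel. norm (g (x + u n) - g x)) - 0) < r"
  proof (intro exI allI impI)
    fix n assume "n \<ge> N"
    then show "norm ((LINT x|lborel. norm (g (x + u n) - g x)) - 0) < r"
      using N[of n] *[of "u n"] by simp
  qed
qed

text \<open>At points of \<open>U\<close> openness gives pointwise convergence of the shifted
  indicators, but on the boundary of \<open>U\<close> it may fail. Since \<open>U\<close> and its
  translates have equal measure, the symmetric difference has twice the measure of the part inside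
  \<open>U\<close>, and dominated convergence is needed there only.\<close>

lemma translation_L1_open:
  fixes U :: "'a::euclidean_space set"
  assumes U: "open U" "emeasure lborel U < \<infinity>" and u: "u \<longlonglongrightarrow> 0"
  shows "(\<lambda>n. LINT x|lborel. norm (indicat_real U (x + u n) - indicat_real U x)) \<longlonglongrightarrow> 0"
proof -
  let ?I = "indicat_real U"
  have [measurable]: "U \<in> sets borel" using U by simp
  have I: "integrable lborel ?I"
    using U by (subst integrable_indicator_iff) auto
  have I': "integrable lborel (\<lambda>x. ?I (x + v))" for v
    by (rule integrable_lborel_shift[OF I])
  have J: "integrable lborel (\<lambda>x. ?I x * (1 - ?I (x + v)))" for v
    by (rule Bochner_Integration.integrable_bound[OF I]) (auto simp: indicator_def)
  have "(LINT x|lborel. norm (?I (x + v) - ?I x)) = 2 * (LINT x|lborel. ?I x * (1 - ?I (x + v)))" for v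
  proof -
    \<comment> \<open>For a and b in {0, 1}, |b - a| = (b - a) + 2 a (1 - b); the difference b - a
      integrates to 0 by translation invariance.\<close>
    have "(LINT x|lborel. norm (?I (x + v) - ?I x))
        = (LINT x|lborel. (?I (x + v) - ?I x) + 2 * (?I x * (1 - ?I (x + v))))"
      by (intro Bochner_Integration.integral_cong) (auto simp: indicator_def)
    also have "\<dots> = (LINT x|lborel. ?I (x + v)) - (LINT x|lborel. ?I x) + 2 * (LINT x|lborel. ?I x * (1 - ?I (x + v)))"
      using I I' J by simp
    also have "(LINT x|lborel. ?I (x + v)) = (LINT x|lborel. ?I x)"
      by (rule integral_lborel_shift)
    finally show ?thesis by simp
  qed
  moreover have "(\<lambda>n. LINT x|lborel. ?I x * (1 - ?I (x + u n))) \<longlonglongrightarrow> (LINT (x::'a)|lborel. (0::real))"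
  proof (rule integral_dominated_convergence[where w = ?I])
    show "AE x in lborel. (\<lambda>n. ?I x * (1 - ?I (x + u n))) \<longlonglongrightarrow> 0"
    proof (rule AE_I2)
      fix x
      show "(\<lambda>n. ?I x * (1 - ?I (x + u n))) \<longlonglongrightarrow> 0"
      proof (cases "x \<in> U")
        case True
        have "(\<lambda>n. x + u n) \<longlonglongrightarrow> x"
          using tendsto_add[OF tendsto_const[of x] u] by simp
        then have "eventually (\<lambda>n. x + u n \<in> U) sequentially"
          using topological_tendstoD U(1) True by blast
        then have "eventually (\<lambda>n. 0 = ?I x * (1 - ?I (x + u n))) sequentially"
          by eventually_elim auto
        then show ?thesis by (rule Lim_transform_eventually[OF tendsto_const])
      qed simp
    qed
  qed (use I in \<open>auto simp: indicator_def\<close>)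
  ultimately show ?thesis
    using tendsto_mult_right_zero by fastforce
qed

text \<open>Induction over integrable functions: outer regularity reduces indicators of measurable
  sets to open sets, sums follow from the triangle inequality, and dominated limits from
  \<open>translation_L1_approx\<close>.\<close>

theorem translation_L1:
  fixes g :: "'a::euclidean_space \<Rightarrow> 'b::{banach, second_countable_topology}"
  assumes g: "integrable lborel g" and u: "u \<longlonglongrightarrow> 0"
  shows "(\<lambda>n. LINT x|lborel. norm (g (x + u n) - g x)) \<longlonglongrightarrow> 0"
  using g
proof (induction rule: integrable_induct)
  case (base A c)
  have [measurable]: "A \<in> sets borel" using base by simp
  show ?case
  proof (rule translation_L1_approx)
    show "integrable lborel (\<lambda>x. indicat_real A x *\<^sub>R c)"
      using base by (intro integrable_scaleR_left) (auto simp: integrable_indicator_iff)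
    fix e :: real assume "e > 0"
    \<comment> \<open>The summand 1 keeps the denominator positive when \<open>c = 0\<close>, and
      still \<open>d * norm c \<le> e\<close>.\<close>
    define d where "d = e / (norm c + 1)"
    have "d > 0" unfolding d_def using \<open>e > 0\<close> by (simp add: add_nonneg_pos)
    obtain U where U: "open U" "A \<subseteq> U" "emeasure lborel (U - A) \<le> d"
      using outer_regular_lborel_le[of A d] \<open>d > 0\<close> by auto
    have [measurable]: "U \<in> sets borel" using U by simp
    have "emeasure lborel U = emeasure lborel A + emeasure lborel (U - A)"
      using U by (subst plus_emeasure) (auto intro!: arg_cong[of _ _ "emeasure lborel"])
    also have "\<dots> < \<infinity>" using base(2) U(3)
      by (metis ennreal_add_less_top ennreal_less_top infinity_ennreal_def le_less_trans)
    finally have fin: "emeasure lborel U < \<infinity>" .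
    let ?g' = "\<lambda>x. indicat_real U x *\<^sub>R c"
    have 1: "integrable lborel ?g'"
      using fin by (intro integrable_scaleR_left) (auto simp: integrable_indicator_iff)
    have "(LINT x|lborel. norm (indicat_real A x *\<^sub>R c - ?g' x)) = (LINT x|lborel. indicat_real (U - A) x * norm c)"
      using U(2) by (intro Bochner_Integration.integral_cong) (auto simp: indicator_def)
    also have "\<dots> = measure lborel (U - A) * norm c" by simp
    also have "\<dots> \<le> d * norm c"
      using U(3) \<open>d > 0\<close> by (intro mult_right_mono) (auto simp: measure_def enn2real_leI)
    also have "\<dots> \<le> e"
    proof -
      have "d * (norm c + 1) = e" unfolding d_def using norm_ge_zero[of c] by (simp add: add_nonneg_eq_0_iff)
      then show ?thesis using \<open>d > 0\<close> by (simp add: algebra_simps)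
    qed
    finally have 2: "(LINT x|lborel. norm (indicat_real A x *\<^sub>R c - ?g' x)) \<le> e" .
    have "(\<lambda>n. (LINT x|lborel. norm (indicat_real U (x + u n) - indicat_real U x)) * norm c) \<longlonglongrightarrow> 0 * norm c"
      by (intro tendsto_mult translation_L1_open U fin u tendsto_const)
    also have "(\<lambda>n. (LINT x|lborel. norm (indicat_real U (x + u n) - indicat_real U x)) * norm c)
        = (\<lambda>n. LINT x|lborel. norm (?g' (x + u n) - ?g' x))"
      by (simp flip: scaleR_diff_left)
    finally have 3: "(\<lambda>n. LINT x|lborel. norm (?g' (x + u n) - ?g' x)) \<longlonglongrightarrow> 0" by simp
    show "\<exists>g'. integrable lborel g' \<and> (LINT x|lborel. norm (indicat_real A x *\<^sub>R c - g' x)) \<le> e \<and>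
      (\<lambda>n. LINT x|lborel. norm (g' (x + u n) - g' x)) \<longlonglongrightarrow> 0"
      using 1 2 3 by blast
  qed
next
  case (add f g)
  have *: "(\<lambda>n. (LINT x|lborel. norm (f (x + u n) - f x)) + (LINT x|lborel. norm (g (x + u n) - g x))) \<longlonglongrightarrow> 0"
    using tendsto_add[OF add(3,4)] by simp
  show ?case
  proof (rule Lim_null_comparison[OF _ *])
    show "\<forall>\<^sub>F n in sequentially. norm (LINT x|lborel. norm (f (x + u n) + g (x + u n) - (f x + g x)))
       \<le> (LINT x|lborel. norm (f (x + u n) - f x)) + (LINT x|lborel. norm (g (x + u n) - g x))"
    proof (rule always_eventually, rule allI)
      fix n
      have "(LINT x|lborel. norm (f (x + u n) + g (x + u n) - (f x + g x)))
        \<le> (LINT x|lborel. norm (f (x + u n) - f x) + norm (g (x + u n) - g x))"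
        by (intro integral_mono integrable_norm Bochner_Integration.integrable_add
            Bochner_Integration.integrable_diff integrable_lborel_shift add) norm
      also have "\<dots> = (LINT x|lborel. norm (f (x + u n) - f x)) + (LINT x|lborel. norm (g (x + u n) - g x))"
        by (intro Bochner_Integration.integral_add integrable_norm
            Bochner_Integration.integrable_diff integrable_lborel_shift add)
      finally show "norm (LINT x|lborel. norm (f (x + u n) + g (x + u n) - (f x + g x)))
       \<le> (LINT x|lborel. norm (f (x + u n) - f x)) + (LINT x|lborel. norm (g (x + u n) - g x))" by simp
    qed
  qed
next
  case (lim f s)
  show ?case
  proof (rule translation_L1_approx)
    fix e :: real assume "e > 0"
    have [measurable]: "f \<in> borel_measurable borel" "\<And>i. s i \<in> borel_measurable borel"
      using lim by (auto dest: borel_measurable_integrable)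
    have bd: "norm (s i x) \<le> 2 * norm (f x)" for i x
      using lim by simp
    \<comment> \<open>The approximants satisfy \<open>norm (s i x) \<le> 2 * norm (f x)\<close>, so
      \<open>3 * norm (f x)\<close> dominates the error and some \<open>s i\<close> is close to
      \<open>f\<close> in L^1.\<close>
    have L: "(\<lambda>i. LINT x|lborel. norm (f x - s i x)) \<longlonglongrightarrow> (LINT (x::'a)|lborel. (0::real))"
    proof (rule integral_dominated_convergence[where w = "\<lambda>x. 3 * norm (f x)"])
      show "integrable lborel (\<lambda>x. 3 * norm (f x))" using lim by auto
      show "AE x in lborel. (\<lambda>i. norm (f x - s i x)) \<longlonglongrightarrow> 0"
      proof (rule AE_I2)
        fix x
        have "(\<lambda>i. norm (f x - s i x)) \<longlonglongrightarrow> norm (f x - f x)"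
          by (intro tendsto_intros lim) simp
        then show "(\<lambda>i. norm (f x - s i x)) \<longlonglongrightarrow> 0" by simp
      qed
      show "AE x in lborel. norm (norm (f x - s i x)) \<le> 3 * norm (f x)" for i
      proof (rule AE_I2)
        fix x
        show "norm (norm (f x - s i x)) \<le> 3 * norm (f x)"
          using norm_triangle_ineq4[of "f x" "s i x"] bd[of i x] by simp
      qed
    qed auto
    obtain i where "norm ((LINT x|lborel. norm (f x - s i x)) - (LINT (x::'a)|lborel. (0::real))) < e"
      using LIMSEQ_D[OF L \<open>e > 0\<close>] by blast
    then show "\<exists>g'. integrable lborel g' \<and> (LINT x|lborel. norm (f x - g' x)) \<le> e \<and>
      (\<lambda>n. LINT x|lborel. norm (g' (x + u n) - g' x)) \<longlonglongrightarrow> 0"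
      using lim by (intro exI[of _ "s i"]) auto
  qed (rule lim)
qed

section \<open>From L^1 to L^2 by the signed square\<close>

text \<open>For equal signs the right-hand difference factors as |a - b| |a + b|, and |a - b| is at
  most |a + b|. For opposite signs it equals a^2 + b^2 up to sign, and the parallelogram law
  accounts for the factor 2.\<close>

lemma power2_diff_le_signed_square:
  fixes a b :: real
  shows "(a - b)\<^sup>2 \<le> 2 * \<bar>a * \<bar>a\<bar> - b * \<bar>b\<bar>\<bar>"
proof -
  have mixed: "(a - b)\<^sup>2 \<le> 2 * \<bar>a * \<bar>a\<bar> - b * \<bar>b\<bar>\<bar>" if "a \<ge> 0" "b \<le> 0" for a b :: real
  proof -
    have "a * \<bar>a\<bar> - b * \<bar>b\<bar> = a\<^sup>2 + b\<^sup>2" using that by (simp add: power2_eq_square)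
    moreover have "(a - b)\<^sup>2 + (a + b)\<^sup>2 = 2 * (a\<^sup>2 + b\<^sup>2)" by (simp add: power2_eq_square algebra_simps)
    then have "(a - b)\<^sup>2 \<le> 2 * (a\<^sup>2 + b\<^sup>2)" using zero_le_power2[of "a + b"] by linarith
    ultimately show ?thesis by simp
  qed
  have pos: "(a - b)\<^sup>2 \<le> 2 * \<bar>a * \<bar>a\<bar> - b * \<bar>b\<bar>\<bar>" if "a \<ge> 0" "b \<ge> 0" for a b :: real
  proof -
    have "\<bar>a - b\<bar> * \<bar>a - b\<bar> \<le> \<bar>a - b\<bar> * \<bar>a + b\<bar>"
      using that by (intro mult_left_mono) auto
    also have "\<dots> = \<bar>a * \<bar>a\<bar> - b * \<bar>b\<bar>\<bar>"
      using that unfolding abs_mult[symmetric] by (simp add: algebra_simps)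
    also have "\<dots> \<le> 2 * \<dots>" by simp
    finally show ?thesis by (simp add: power2_eq_square)
  qed
  \<comment> \<open>The last two sign patterns reduce to the first two by exchanging
    \<open>a\<close> and \<open>b\<close>, or by negating both.\<close>
  consider "a \<ge> 0" "b \<ge> 0" | "a \<ge> 0" "b \<le> 0" | "a \<le> 0" "b \<ge> 0" | "a \<le> 0" "b \<le> 0" by linarith
  then show ?thesis
  proof cases
    case 3 then show ?thesis using mixed[of b a] by (simp add: power2_commute abs_minus_commute)
  next
    case 4 then show ?thesis using pos[of "- a" "- b"] by (simp add: power2_commute abs_minus_commute)
  qed (use pos mixed in auto)
qed

text \<open>Componentwise \<open>t \<mapsto> t\<bar>t\<bar>\<close>: it maps \<open>L\<^sup>2\<close> to \<open>L\<^sup>1\<close> and reduces continuity of translation in \<open>L\<^sup>2\<close>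
  to continuity in \<open>L\<^sup>1\<close>.\<close>
definition signed_square :: "'b::euclidean_space \<Rightarrow> 'b" where
  "signed_square p = (\<Sum>b\<in>Basis. ((p \<bullet> b) * \<bar>p \<bullet> b\<bar>) *\<^sub>R b)"

lemma norm_signed_square_le: "norm (signed_square p) \<le> (norm p)\<^sup>2"
proof -
  have "norm (signed_square p) \<le> (\<Sum>b\<in>Basis. (p \<bullet> b)\<^sup>2)"
    unfolding signed_square_def by (rule sum_norm_le) (simp add: abs_mult power2_eq_square)
  also have "\<dots> = (norm p)\<^sup>2"
    by (subst power2_norm_eq_inner, subst euclidean_inner) (simp add: power2_eq_square)
  finally show ?thesis .
qed

text \<open>The scalar inequality is applied in each coordinate; bounding every coordinate of the
  signed squares by the full norm produces the factor \<open>DIM('b)\<close>.\<close>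

lemma power2_norm_diff_le_signed_square:
  fixes p q :: "'b::euclidean_space"
  shows "(norm (p - q))\<^sup>2 \<le> 2 * DIM('b) * norm (signed_square p - signed_square q)"
proof -
  have "(norm (p - q))\<^sup>2 = (\<Sum>b\<in>Basis. (p \<bullet> b - q \<bullet> b)\<^sup>2)"
    by (subst power2_norm_eq_inner, subst euclidean_inner) (simp add: power2_eq_square inner_diff_left)
  also have "\<dots> \<le> (\<Sum>b\<in>(Basis::'b set). 2 * norm (signed_square p - signed_square q))"
  proof (rule sum_mono)
    fix b :: 'b assume b: "b \<in> Basis"
    have "(p \<bullet> b - q \<bullet> b)\<^sup>2 \<le> 2 * \<bar>(p \<bullet> b) * \<bar>p \<bullet> b\<bar> - (q \<bullet> b) * \<bar>q \<bullet> b\<bar>\<bar>"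
      by (rule power2_diff_le_signed_square)
    also have "(p \<bullet> b) * \<bar>p \<bullet> b\<bar> - (q \<bullet> b) * \<bar>q \<bullet> b\<bar> = (signed_square p - signed_square q) \<bullet> b"
      using b by (simp add: signed_square_def inner_diff_left)
    also have "\<bar>\<dots>\<bar> \<le> norm (signed_square p - signed_square q)"
      by (rule Basis_le_norm[OF b])
    finally show "(p \<bullet> b - q \<bullet> b)\<^sup>2 \<le> 2 * norm (signed_square p - signed_square q)" by simp
  qed
  finally show ?thesis by simp
qed

lemma integrable_power2_norm_shift_diff:
  fixes h :: "'a::euclidean_space \<Rightarrow> 'b::euclidean_space"
  assumes [measurable]: "h \<in> borel_measurable borel" and h: "integrable lborel (\<lambda>x. (norm (h x))\<^sup>2)"
  shows "integrable lborel (\<lambda>x. (norm (h (x + u) - h x))\<^sup>2)"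
proof (rule Bochner_Integration.integrable_bound)
  show "integrable lborel (\<lambda>x. 2 * (norm (h (x + u)))\<^sup>2 + 2 * (norm (h x))\<^sup>2)"
    using h integrable_lborel_shift[OF h, of u] by simp
  \<comment> \<open>Parallelogram law, with the square of \<open>norm (p + q)\<close>
    dropped.\<close>
  have "(norm (p - q))\<^sup>2 \<le> 2 * (norm p)\<^sup>2 + 2 * (norm q)\<^sup>2" for p q :: 'b
    using zero_le_power2[of "norm (p + q)"] unfolding power2_norm_eq_inner
    by (simp add: algebra_simps inner_commute)
  then show "AE x in lborel. norm ((norm (h (x + u) - h x))\<^sup>2) \<le> norm (2 * (norm (h (x + u)))\<^sup>2 + 2 * (norm (h x))\<^sup>2)"
    by simp
qed measurable

text \<open>The squared L^2 displacement of \<open>h\<close> is at most a constant times the L^1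
  displacement of \<open>signed_square\<close> composed with \<open>h\<close>, to which
  \<open>translation_L1\<close> applies.\<close>

theorem translation_L2:
  fixes h :: "'a::euclidean_space \<Rightarrow> 'b::euclidean_space"
  assumes [measurable]: "h \<in> borel_measurable borel" and h: "integrable lborel (\<lambda>x. (norm (h x))\<^sup>2)"
    and u: "u \<longlonglongrightarrow> 0"
  shows "(\<lambda>n. LINT x|lborel. (norm (h (x + u n) - h x))\<^sup>2) \<longlonglongrightarrow> 0"
proof (rule Lim_null_comparison)
  have g: "integrable lborel (\<lambda>x. signed_square (h x))"
  proof (rule Bochner_Integration.integrable_bound[OF h])
    show "(\<lambda>x. signed_square (h x)) \<in> borel_measurable lborel"
      unfolding signed_square_def by measurable
  qed (use norm_signed_square_le in auto)
  show "(\<lambda>n. 2 * DIM('b) * (LINT x|lborel. norm (signed_square (h (x + u n)) - signed_square (h x)))) \<longlonglongrightarrow> 0"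
    using tendsto_mult[OF tendsto_const translation_L1[OF g u]] by simp
  show "\<forall>\<^sub>F n in sequentially. norm (LINT x|lborel. (norm (h (x + u n) - h x))\<^sup>2)
      \<le> 2 * DIM('b) * (LINT x|lborel. norm (signed_square (h (x + u n)) - signed_square (h x)))"
  proof (rule always_eventually, rule allI)
    fix n
    have "(LINT x|lborel. (norm (h (x + u n) - h x))\<^sup>2)
        \<le> (LINT x|lborel. 2 * DIM('b) * norm (signed_square (h (x + u n)) - signed_square (h x)))"
      using integrable_lborel_shift[OF g, of "u n"] g
      by (intro integral_mono integrable_power2_norm_shift_diff h power2_norm_diff_le_signed_square
          integrable_mult_right integrable_norm Bochner_Integration.integrable_diff) auto
    then show "norm (LINT x|lborel. (norm (h (x + u n) - h x))\<^sup>2)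
      \<le> 2 * DIM('b) * (LINT x|lborel. norm (signed_square (h (x + u n)) - signed_square (h x)))" by simp
  qed
qed

subsection \<open>Gaussian means of the quaternion Fourier transform\<close>

lemma norm_qcnj [simp]: "norm (qcnj q) = norm q"
  by (simp add: norm_quat_def inner_quat_def)

lemma bounded_linear_quat_of_complex:
  "bounded_linear (\<lambda>z. Re z *\<^sub>R (1::quat) + Im z *\<^sub>R q)"
  by (intro bounded_linear_add bounded_linear_scaleR_const bounded_linear_Re bounded_linear_Im)

text \<open>Euler's formula transported from the complex numbers: since \<open>q * q = - 1\<close>,
  the map sending 1 to 1 and \<i> to \<open>q\<close> is multiplicative, and being bounded and
  linear it carries the exponential series of \<open>\<i> * t\<close> to that of
  \<open>t *\<^sub>R q\<close>.\<close>

lemma exp_quat_unit: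
  fixes q :: quat
  assumes "q * q = - 1"
  shows "exp (t *\<^sub>R q) = cos t *\<^sub>R 1 + sin t *\<^sub>R q"
proof -
  define \<phi> where "\<phi> z = Re z *\<^sub>R (1::quat) + Im z *\<^sub>R q" for z
  have lin: "bounded_linear \<phi>"
    unfolding \<phi>_def by (rule bounded_linear_quat_of_complex)
  have mult: "\<phi> (z * w) = \<phi> z * \<phi> w" for z w
    by (simp add: \<phi>_def algebra_simps assms flip: scaleR_left_diff_distrib)
       (simp add: algebra_simps)
  have pow: "\<phi> (z ^ n) = \<phi> z ^ n" for z n
    by (induction n) (simp_all add: mult, simp add: \<phi>_def)
  have "(\<lambda>n. \<phi> ((\<i> * t) ^ n /\<^sub>R fact n)) sums \<phi> (exp (\<i> * t))"
    by (intro bounded_linear.sums[OF lin] exp_converges)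
  also have "(\<lambda>n. \<phi> ((\<i> * t) ^ n /\<^sub>R fact n)) = (\<lambda>n. (t *\<^sub>R q) ^ n /\<^sub>R fact n)"
  proof
    fix n
    have "\<phi> (\<i> * t) = t *\<^sub>R q" by (simp add: \<phi>_def)
    then show "\<phi> ((\<i> * t) ^ n /\<^sub>R fact n) = (t *\<^sub>R q) ^ n /\<^sub>R fact n"
      using linear_scale[OF bounded_linear.linear[OF lin]] by (simp add: pow)
  qed
  finally have "(\<lambda>n. (t *\<^sub>R q) ^ n /\<^sub>R fact n) sums \<phi> (exp (\<i> * t))" .
  then have "exp (t *\<^sub>R q) = \<phi> (exp (\<i> * t))"
    using exp_converges sums_unique2 by blast
  then show ?thesis
    by (simp add: \<phi>_def Re_exp Im_exp)
qed

section \<open>Product integrals and the Gaussian Fourier pair\<close>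

lemma has_bochner_integral_mult_lborel:
  fixes f :: "'a::euclidean_space \<Rightarrow> real" and g :: "'b::euclidean_space \<Rightarrow> real"
  assumes "has_bochner_integral lborel f a" "has_bochner_integral lborel g b"
  shows "has_bochner_integral lborel (\<lambda>x. f (fst x) * g (snd x)) (a * b)"
proof -
  have f: "integrable lborel f" "(LINT x|lborel. f x) = a" and g: "integrable lborel g" "(LINT x|lborel. g x) = b"
    using assms by (auto simp: has_bochner_integral_iff)
  note [measurable] = borel_measurable_integrable[OF f(1)] borel_measurable_integrable[OF g(1)]
  have i: "integrable (lborel \<Otimes>\<^sub>M lborel) (\<lambda>(x, y). f x * g y)"
  proof (rule lborel_pair.Fubini_integrable)
    show "integrable lborel (\<lambda>x. LINT y|lborel. norm (case (x, y) of (x, y) \<Rightarrow> f x * g y))"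
      using f(1) by (simp add: abs_mult)
    show "AE x in lborel. integrable lborel (\<lambda>y. case (x, y) of (x, y) \<Rightarrow> f x * g y)"
      using g(1) by simp
  qed measurable
  moreover have "integral\<^sup>L (lborel \<Otimes>\<^sub>M lborel) (\<lambda>(x, y). f x * g y) = a * b"
    using f g by (subst lborel_pair.integral_fst[symmetric, OF i]) simp
  ultimately show ?thesis
    by (simp add: has_bochner_integral_iff lborel_prod case_prod_beta')
qed

lemma integrable_mult_lborel:
  fixes f :: "'a::euclidean_space \<Rightarrow> real" and g :: "'b::euclidean_space \<Rightarrow> real"
  assumes "integrable lborel f" "integrable lborel g"
  shows "integrable lborel (\<lambda>x. f (fst x) * g (snd x))"
  using has_bochner_integral_mult_lborel[OF has_bochner_integral_integrable[OF assms(1)] has_bochner_integral_integrable[OF assms(2)]]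
  by (simp add: has_bochner_integral_iff)

text \<open>For \<open>e > 0\<close> this is the characteristic function of the centred normal law
  with standard deviation \<open>e\<close>, taken at 2 pi w; \<open>gauss_kernel e\<close> is the
  density of that law. As \<open>e\<close> decreases to 0 the weight increases to 1 and the kernel
  concentrates at 0.\<close>

definition gauss_weight :: "real \<Rightarrow> real \<Rightarrow> real" where
  "gauss_weight e w = exp (- (2 * pi * e * w)\<^sup>2 / 2)"

definition gauss_kernel :: "real \<Rightarrow> real \<Rightarrow> real" where
  "gauss_kernel e u = std_normal_density (u / e) / e"

text \<open>Real and imaginary parts of the characteristic function of the standard normal law,
  which is real-valued.\<close>

lemma fourier_std_normal_density:
  shows fourier_cos_std_normal_density:
      "has_bochner_integral lborel (\<lambda>x. std_normal_density x * cos (t * x)) (exp (- t\<^sup>2 / 2))"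
    and fourier_sin_std_normal_density:
      "has_bochner_integral lborel (\<lambda>x. std_normal_density x * sin (t * x)) 0"
proof -
  have i: "integrable lborel (\<lambda>x. std_normal_density x *\<^sub>R iexp (t * x))"
    by (rule Bochner_Integration.integrable_bound[of _ std_normal_density]) (auto simp: norm_mult)
  have "(LINT x|lborel. std_normal_density x *\<^sub>R iexp (t * x)) = char std_normal_distribution t"
    unfolding char_def by (subst integral_density) auto
  then have h: "has_bochner_integral lborel (\<lambda>x. std_normal_density x *\<^sub>R iexp (t * x)) (of_real (exp (- t\<^sup>2 / 2)))"
    using i by (simp add: has_bochner_integral_iff char_std_normal_distribution)
  show "has_bochner_integral lborel (\<lambda>x. std_normal_density x * cos (t * x)) (exp (- t\<^sup>2 / 2))"
    using has_bochner_integral_Re[OF h] by (simp add: Re_exp)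
  show "has_bochner_integral lborel (\<lambda>x. std_normal_density x * sin (t * x)) 0"
    using has_bochner_integral_Im[OF h] by (simp add: Im_exp)
qed

text \<open>The substitution x = 2 pi e w in the transforms of the standard normal density at t = u
  / e; the Jacobian and the constant \<open>sqrt (2 * pi)\<close> combine to the normalisation of
  \<open>gauss_kernel\<close>.\<close>

lemma
  assumes "e > 0"
  shows fourier_cos_gauss_weight:
      "has_bochner_integral lborel (\<lambda>w. gauss_weight e w * cos (2 * pi * u * w)) (gauss_kernel e u)"
    and fourier_sin_gauss_weight:
      "has_bochner_integral lborel (\<lambda>w. gauss_weight e w * sin (2 * pi * u * w)) 0"
proof -
  let ?c = "2 * pi * e"
  have c: "?c \<noteq> 0" using assms by simp
  have weight: "gauss_weight e w = sqrt (2 * pi) * std_normal_density (?c * w)" for w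
    by (simp add: gauss_weight_def std_normal_density_def)
  have arg: "u / e * (?c * w) = 2 * pi * u * w" for w
    using assms by simp
  have val: "gauss_kernel e u = sqrt (2 * pi) * (exp (- (u / e)\<^sup>2 / 2) /\<^sub>R \<bar>?c\<bar>)"
  proof -
    have "1 / sqrt (2 * pi) = sqrt (2 * pi) / (2 * pi)" by (simp add: real_div_sqrt field_simps)
    then show ?thesis
      using assms by (simp add: gauss_kernel_def std_normal_density_def field_simps)
  qed
  show "has_bochner_integral lborel (\<lambda>w. gauss_weight e w * cos (2 * pi * u * w)) (gauss_kernel e u)"
    using iffD1[OF lborel_has_bochner_integral_real_affine_iff[OF c, where t = 0]
        fourier_cos_std_normal_density[of "u / e"], unfolded add_0 arg]
    unfolding val weight mult.assoc[of "sqrt (2 * pi)"]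
    by (intro has_bochner_integral_mult_right) simp
  have "has_bochner_integral lborel (\<lambda>w. gauss_weight e w * sin (2 * pi * u * w)) (sqrt (2 * pi) * (0 /\<^sub>R \<bar>?c\<bar>))"
    using iffD1[OF lborel_has_bochner_integral_real_affine_iff[OF c, where t = 0]
        fourier_sin_std_normal_density[of "u / e"], unfolded add_0 arg]
    unfolding weight mult.assoc[of "sqrt (2 * pi)"]
    by (intro has_bochner_integral_mult_right) simp
  then show "has_bochner_integral lborel (\<lambda>w. gauss_weight e w * sin (2 * pi * u * w)) 0" by simp
qed

definition gauss_weight2 :: "real \<Rightarrow> real \<times> real \<Rightarrow> real" where
  "gauss_weight2 e w = gauss_weight e (fst w) * gauss_weight e (snd w)"

definition gauss_kernel2 :: "real \<Rightarrow> real \<times> real \<Rightarrow> real" where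
  "gauss_kernel2 e u = gauss_kernel e (fst u) * gauss_kernel e (snd u)"

section \<open>Two-sided modulation and the Gaussian-weighted Parseval identity\<close>

definition qmod :: "real \<times> real \<Rightarrow> real \<times> real \<Rightarrow> quat \<Rightarrow> quat" where
  "qmod w x p = exp ((- (2 * pi * fst x * fst w)) *\<^sub>R quat_i) * p * exp ((- (2 * pi * snd x * snd w)) *\<^sub>R quat_j)"

definition qft :: "(real \<times> real \<Rightarrow> quat) \<Rightarrow> real \<times> real \<Rightarrow> quat" where
  "qft h w = (LINT x|lborel. qmod w x (h x))"

lemma exp_quat_i: "exp (t *\<^sub>R quat_i) = cos t *\<^sub>R 1 + sin t *\<^sub>R quat_i"
  and exp_quat_j: "exp (t *\<^sub>R quat_j) = cos t *\<^sub>R 1 + sin t *\<^sub>R quat_j"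
  by (simp_all add: exp_quat_unit quat_units)

lemma norm_qmod [simp]: "norm (qmod w x p) = norm p"
proof -
  have "(norm (exp (t *\<^sub>R quat_i)))\<^sup>2 = 1\<^sup>2" "(norm (exp (t *\<^sub>R quat_j)))\<^sup>2 = 1\<^sup>2" for t
    unfolding exp_quat_i exp_quat_j quat_norm_sq by simp_all
  then have "norm (exp (t *\<^sub>R quat_i)) = 1" "norm (exp (t *\<^sub>R quat_j)) = 1" for t
    by (simp_all only: power2_eq_iff_nonneg norm_ge_zero zero_le_one)
  then show ?thesis by (simp add: qmod_def norm_mult del: scaleR_minus_left)
qed

text \<open>Multiplication by a unit quaternion is an isometry on either side, so the phases at
  \<open>y\<close> can be moved onto the first argument, leaving only phase differences. Euler's
  formula then expands the left and right factors into four terms.\<close>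

lemma inner_qmod:
  fixes w x y :: "real \<times> real"
  defines "a \<equiv> 2 * pi * (fst x - fst y) * fst w" and "b \<equiv> 2 * pi * (snd x - snd y) * snd w"
  shows "qmod w x p \<bullet> qmod w y q =
    cos a * cos b * (p \<bullet> q) - sin a * cos b * ((quat_i * p) \<bullet> q)
    - cos a * sin b * ((p * quat_j) \<bullet> q) + sin a * sin b * ((quat_i * p * quat_j) \<bullet> q)"
proof -
  define a1 a2 b1 b2 where "a1 = 2 * pi * fst x * fst w" and "a2 = 2 * pi * fst y * fst w"
    and "b1 = 2 * pi * snd x * snd w" and "b2 = 2 * pi * snd y * snd w"
  have ab: "a = a1 - a2" "b = b1 - b2"
    by (simp_all add: a_def b_def a1_def a2_def b1_def b2_def algebra_simps)
  show ?thesis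
    unfolding ab cos_diff sin_diff qmod_def a1_def[symmetric] a2_def[symmetric] b1_def[symmetric] b2_def[symmetric]
      exp_quat_i exp_quat_j inner_quat_def
    by (simp add: algebra_simps)
qed

text \<open>Each term of \<open>inner_qmod\<close> factors over the two frequency coordinates. The
  three terms with a sine have a vanishing factor, and these are exactly the ones where
  \<open>quat_i\<close> and \<open>quat_j\<close> act on \<open>p\<close>; only
  \<open>p \<bullet> q\<close> remains.\<close>

lemma integrate_inner_qmod:
  assumes "e > 0"
  shows "has_bochner_integral lborel (\<lambda>w. gauss_weight2 e w * (qmod w x p \<bullet> qmod w y q))
    (gauss_kernel2 e (x - y) * (p \<bullet> q))"
proof -
  define u v where "u = fst x - fst y" and "v = snd x - snd y"
  let ?C = "\<lambda>u w. gauss_weight e w * cos (2 * pi * u * w)" and ?S = "\<lambda>u w. gauss_weight e w * sin (2 * pi * u * w)"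
  note C = fourier_cos_gauss_weight[OF assms] and S = fourier_sin_gauss_weight[OF assms]
  have "has_bochner_integral lborel
      (\<lambda>w. (?C u (fst w) * ?C v (snd w)) * (p \<bullet> q) - (?S u (fst w) * ?C v (snd w)) * ((quat_i * p) \<bullet> q)
        - (?C u (fst w) * ?S v (snd w)) * ((p * quat_j) \<bullet> q) + (?S u (fst w) * ?S v (snd w)) * ((quat_i * p * quat_j) \<bullet> q))
      ((gauss_kernel e u * gauss_kernel e v) * (p \<bullet> q) - (0 * gauss_kernel e v) * ((quat_i * p) \<bullet> q)
        - (gauss_kernel e u * 0) * ((p * quat_j) \<bullet> q) + (0 * 0) * ((quat_i * p * quat_j) \<bullet> q))"
    by (intro has_bochner_integral_add has_bochner_integral_diff has_bochner_integral_mult_left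
        has_bochner_integral_mult_lborel C S)
  then show ?thesis
    unfolding inner_qmod gauss_weight2_def gauss_kernel2_def u_def v_def
    by (simp add: algebra_simps)
qed

lemma
  fixes f :: "'c \<Rightarrow> 'a::second_countable_topology \<times> 'b::second_countable_topology"
  assumes "f \<in> borel_measurable M"
  shows borel_measurable_fst' [measurable (raw)]: "(\<lambda>x. fst (f x)) \<in> borel_measurable M"
    and borel_measurable_snd' [measurable (raw)]: "(\<lambda>x. snd (f x)) \<in> borel_measurable M"
  using measurable_compose[OF assms borel_measurable_continuous_onI[OF continuous_on_fst[OF continuous_on_id]]]
    measurable_compose[OF assms borel_measurable_continuous_onI[OF continuous_on_snd[OF continuous_on_id]]]
  by simp_all

lemma borel_measurable_qmod [measurable (raw)]:
  assumes [measurable]: "f \<in> borel_measurable M" "g \<in> borel_measurable M" "h \<in> borel_measurable M"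
  shows "(\<lambda>x. qmod (f x) (g x) (h x)) \<in> borel_measurable M"
  unfolding qmod_def exp_quat_i exp_quat_j by measurable

lemma borel_measurable_gauss [measurable]:
  "gauss_weight2 e \<in> borel_measurable borel" "gauss_kernel2 e \<in> borel_measurable borel"
  unfolding gauss_weight2_def[abs_def] gauss_kernel2_def[abs_def] gauss_weight_def gauss_kernel_def
  by measurable

lemma gauss_weight2_pos: "gauss_weight2 e w > 0"
  by (simp add: gauss_weight2_def gauss_weight_def)

lemma gauss_kernel2_nonneg: "e > 0 \<Longrightarrow> gauss_kernel2 e u \<ge> 0"
  by (simp add: gauss_kernel2_def gauss_kernel_def)

text \<open>Supplies the constant bound on the kernel in the integrability proof of
  \<open>gauss_kernel_autocorrelation\<close>.\<close>

lemma gauss_kernel2_le: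
  assumes "e > 0" shows "gauss_kernel2 e u \<le> gauss_kernel2 e 0"
proof -
  have "gauss_kernel e t \<le> gauss_kernel e 0" for t
    using assms by (simp add: gauss_kernel_def std_normal_density_def divide_right_mono)
  moreover have "gauss_kernel e t \<ge> 0" for t
    using assms by (simp add: gauss_kernel_def)
  ultimately show ?thesis
    unfolding gauss_kernel2_def by (intro mult_mono) auto
qed

lemma gauss_kernel2_minus: "gauss_kernel2 e (- u) = gauss_kernel2 e u"
  by (simp add: gauss_kernel2_def gauss_kernel_def std_normal_density_def)

lemma integrable_gauss_weight2:
  assumes "e > 0" shows "integrable lborel (gauss_weight2 e)"
proof -
  have "integrable lborel (gauss_weight e)"
    using fourier_cos_gauss_weight[OF assms, of 0] by (simp add: has_bochner_integral_iff)
  from integrable_mult_lborel[OF this this] show ?thesis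
    by (simp add: gauss_weight2_def[abs_def])
qed

text \<open>The squared norm of \<open>qft h w\<close> is a double integral over pairs of points.
  The integrable weight makes the integral over frequency and pairs absolutely convergent, so Fubini
  allows the frequency to be integrated first, by \<open>integrate_inner_qmod\<close>.\<close>

lemma gauss_parseval:
  assumes e: "e > 0" and h: "integrable lborel h"
  shows "has_bochner_integral lborel (\<lambda>w. gauss_weight2 e w * (norm (qft h w))\<^sup>2)
    (LINT z|lborel. gauss_kernel2 e (fst z - snd z) * (h (fst z) \<bullet> h (snd z)))"
proof -
  have [measurable]: "h \<in> borel_measurable borel"
    using borel_measurable_integrable[OF h] by simp
  define H where "H w z = qmod w (fst z) (h (fst z)) \<bullet> qmod w (snd z) (h (snd z))" for w z
  have H_meas [measurable]: "(\<lambda>p. H (fst p) (snd p)) \<in> borel_measurable borel"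
    unfolding H_def by measurable
  have H_le: "\<bar>H w z\<bar> \<le> norm (h (fst z)) * norm (h (snd z))" for w z
    unfolding H_def using Cauchy_Schwarz_ineq2[of "qmod w (fst z) (h (fst z))" "qmod w (snd z) (h (snd z))"] by simp
  have dom: "integrable lborel (\<lambda>z. norm (h (fst z)) * norm (h (snd z)))"
    using h by (intro integrable_mult_lborel integrable_norm)
  have iH: "integrable (lborel \<Otimes>\<^sub>M lborel) (\<lambda>(w, z). gauss_weight2 e w * H w z)"
    unfolding lborel_prod
  proof (rule Bochner_Integration.integrable_bound)
    show "integrable lborel (\<lambda>p. gauss_weight2 e (fst p) * (norm (h (fst (snd p))) * norm (h (snd (snd p)))))"
      by (rule integrable_mult_lborel[OF integrable_gauss_weight2[OF e] dom])
    show "(\<lambda>(w, z). gauss_weight2 e w * H w z) \<in> borel_measurable lborel"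
      unfolding case_prod_beta' by measurable
    show "AE x in lborel. norm (case x of (w, z) \<Rightarrow> gauss_weight2 e w * H w z)
        \<le> norm (gauss_weight2 e (fst x) * (norm (h (fst (snd x))) * norm (h (snd (snd x)))))"
      using gauss_weight2_pos[THEN less_imp_le] H_le
      by (intro AE_I2) (auto simp: abs_mult intro!: mult_left_mono)
  qed
  have q: "integrable lborel (\<lambda>x. qmod w x (h x))" for w
    by (rule Bochner_Integration.integrable_bound[OF h]) auto
  \<comment> \<open>Fubini, after which the inner product is pulled out of each of the two
    integrals.\<close>
  have sq: "(LINT z|lborel. H w z) = (norm (qft h w))\<^sup>2" for w
  proof -
    have i: "integrable (lborel \<Otimes>\<^sub>M lborel) (\<lambda>(x, y). H w (x, y))"
      unfolding lborel_prod
    proof (rule Bochner_Integration.integrable_bound[OF dom])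
      show "(\<lambda>(x, y). H w (x, y)) \<in> borel_measurable lborel"
        unfolding H_def case_prod_beta' by measurable
    qed (use H_le in auto)
    have "(LINT z|lborel. H w z) = (LINT z|(lborel \<Otimes>\<^sub>M lborel). (\<lambda>(x, y). H w (x, y)) z)"
      by (simp add: lborel_prod)
    also have "\<dots> = (LINT x|lborel. LINT y|lborel. H w (x, y))"
      using lborel_pair.integral_fst[OF i] by simp
    also have "\<dots> = qft h w \<bullet> qft h w"
      using q[of w] by (simp add: H_def qft_def)
    finally show ?thesis by (simp add: power2_norm_eq_inner)
  qed
  have "(LINT w|lborel. gauss_weight2 e w * (norm (qft h w))\<^sup>2) = (LINT w|lborel. LINT z|lborel. gauss_weight2 e w * H w z)"
    by (simp add: sq)
  also have "\<dots> = (LINT z|lborel. LINT w|lborel. gauss_weight2 e w * H w z)"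
    by (rule lborel_pair.Fubini_integral[symmetric, OF iH])
  also have "\<dots> = (LINT z|lborel. gauss_kernel2 e (fst z - snd z) * (h (fst z) \<bullet> h (snd z)))"
    using integrate_inner_qmod[OF e] by (simp add: H_def has_bochner_integral_iff)
  finally show ?thesis
    using lborel_pair.integrable_fst[OF iH] by (simp add: has_bochner_integral_iff sq)
qed

section \<open>Autocorrelation and the Gaussian approximate identity\<close>

definition autocorrelation :: "('a::euclidean_space \<Rightarrow> 'b::euclidean_space) \<Rightarrow> 'a \<Rightarrow> real" where
  "autocorrelation h u = (LINT x|lborel. h x \<bullet> h (x + u))"

lemma borel_measurable_autocorrelation [measurable]:
  assumes [measurable]: "h \<in> borel_measurable borel"
  shows "autocorrelation h \<in> borel_measurable borel"
  unfolding autocorrelation_def by measurable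

text \<open>The substitution y = u + x in the inner integral, followed by Fubini; the kernel then
  sees only -u and is even.\<close>

lemma gauss_kernel_autocorrelation:
  assumes e: "e > 0" and h: "integrable lborel h"
  shows "(LINT z|lborel. gauss_kernel2 e (fst z - snd z) * (h (fst z) \<bullet> h (snd z)))
    = (LINT u|lborel. gauss_kernel2 e u * autocorrelation (h :: _ \<Rightarrow> 'b::euclidean_space) u)"
proof -
  have [measurable]: "h \<in> borel_measurable borel"
    using borel_measurable_integrable[OF h] by simp
  let ?G = "\<lambda>x y. gauss_kernel2 e (x - y) * (h x \<bullet> h y)"
  have le: "\<bar>?G x y\<bar> \<le> \<bar>gauss_kernel2 e 0\<bar> * (norm (h x) * norm (h y))" for x y
    unfolding abs_mult[of "gauss_kernel2 e (x - y)"]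
    by (intro mult_mono) (use gauss_kernel2_nonneg[OF e] gauss_kernel2_le[OF e] Cauchy_Schwarz_ineq2 in auto)
  have i: "integrable (lborel \<Otimes>\<^sub>M lborel) (\<lambda>(x, y). ?G x y)"
    unfolding lborel_prod
  proof (rule Bochner_Integration.integrable_bound)
    show "integrable lborel (\<lambda>z. gauss_kernel2 e 0 * (norm (h (fst z)) * norm (h (snd z))))"
      using h by (intro integrable_mult_right integrable_mult_lborel integrable_norm)
    show "(\<lambda>(x, y). ?G x y) \<in> borel_measurable lborel"
      unfolding case_prod_beta' by measurable
    show "AE z in lborel. norm (case z of (x, y) \<Rightarrow> ?G x y) \<le> norm (gauss_kernel2 e 0 * (norm (h (fst z)) * norm (h (snd z))))"
      using le by (intro AE_I2) (auto simp: abs_mult)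
  qed
  \<comment> \<open>Integrability of the sheared integrand is inherited slice by slice: for fixed
    \<open>x\<close> it is a translate of \<open>?G x\<close>.\<close>
  have i': "integrable (lborel \<Otimes>\<^sub>M lborel) (\<lambda>(x, u). ?G x (u + x))"
  proof (rule lborel_pair.Fubini_integrable)
    have "(\<lambda>x. LINT u|lborel. norm (case (x, u) of (x, u) \<Rightarrow> ?G x (u + x))) = (\<lambda>x. LINT y|lborel. norm (?G x y))"
      using integral_lborel_shift[of "\<lambda>y. norm (?G x y)" x for x] by simp
    moreover have "integrable lborel (\<lambda>x. LINT y|lborel. norm (?G x y))"
      using integrable_norm[OF i] by (intro lborel_pair.integrable_fst) (simp add: case_prod_beta')
    ultimately show "integrable lborel (\<lambda>x. LINT u|lborel. norm (case (x, u) of (x, u) \<Rightarrow> ?G x (u + x)))"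
      by simp
    show "AE x in lborel. integrable lborel (\<lambda>u. case (x, u) of (x, u) \<Rightarrow> ?G x (u + x))"
      using lborel_pair.AE_integrable_fst[OF i]
      by eventually_elim (use integrable_lborel_shift in \<open>simp only: prod.case\<close>)
    show "(\<lambda>(x, u). ?G x (u + x)) \<in> borel_measurable (lborel \<Otimes>\<^sub>M lborel)"
      unfolding lborel_prod case_prod_beta' by measurable
  qed
  have "(LINT z|lborel. ?G (fst z) (snd z)) = (LINT z|(lborel \<Otimes>\<^sub>M lborel). (\<lambda>(x, y). ?G x y) z)"
    by (simp add: lborel_prod case_prod_beta')
  also have "\<dots> = (LINT x|lborel. LINT y|lborel. ?G x y)"
    using lborel_pair.integral_fst[OF i] by simp
  also have "\<dots> = (LINT x|lborel. LINT u|lborel. ?G x (u + x))"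
    using integral_lborel_shift[of "?G x" x for x] by simp
  also have "\<dots> = (LINT u|lborel. LINT x|lborel. ?G x (u + x))"
    by (rule lborel_pair.Fubini_integral[symmetric, OF i'])
  also have "\<dots> = (LINT u|lborel. gauss_kernel2 e u * autocorrelation h u)"
    by (simp add: autocorrelation_def gauss_kernel2_minus add.commute)
  finally show ?thesis .
qed

text \<open>The equation is polarization with translation invariance of the norm; it turns L^2
  continuity of translation into continuity of the autocorrelation at 0. The bound follows from
  Cauchy-Schwarz and the inequality 2 a b \<le> a^2 + b^2.\<close>

lemma
  fixes h :: "'a::euclidean_space \<Rightarrow> 'b::euclidean_space"
  assumes [measurable]: "h \<in> borel_measurable borel" and h: "integrable lborel (\<lambda>x. (norm (h x))\<^sup>2)"
  shows autocorrelation_eq: "autocorrelation h u =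
      (LINT x|lborel. (norm (h x))\<^sup>2) - (LINT x|lborel. (norm (h (x + u) - h x))\<^sup>2) / 2"
    and abs_autocorrelation_le: "\<bar>autocorrelation h u\<bar> \<le> (LINT x|lborel. (norm (h x))\<^sup>2)"
proof -
  let ?N = "LINT x|lborel. (norm (h x))\<^sup>2"
  note h' = integrable_lborel_shift[OF h, of u]
  have s: "(LINT x|lborel. (norm (h (x + u)))\<^sup>2) = ?N"
    using integral_lborel_shift[of "\<lambda>x. (norm (h x))\<^sup>2"] .
  note d = integrable_power2_norm_shift_diff[OF assms, of u]
  have eq: "h x \<bullet> h (x + u) = ((norm (h x))\<^sup>2 + (norm (h (x + u)))\<^sup>2 - (norm (h (x + u) - h x))\<^sup>2) / 2" for x
    by (simp add: power2_norm_eq_inner algebra_simps inner_commute)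
  show *: "autocorrelation h u = ?N - (LINT x|lborel. (norm (h (x + u) - h x))\<^sup>2) / 2"
    unfolding autocorrelation_def eq using h h' d s by simp
  have "\<bar>autocorrelation h u\<bar> \<le> (LINT x|lborel. \<bar>h x \<bullet> h (x + u)\<bar>)"
    unfolding autocorrelation_def using integral_norm_bound[of lborel "\<lambda>x. h x \<bullet> h (x + u)"] by simp
  also have "\<dots> \<le> (LINT x|lborel. ((norm (h x))\<^sup>2 + (norm (h (x + u)))\<^sup>2) / 2)"
  proof (rule integral_mono)
    show "integrable lborel (\<lambda>x. \<bar>h x \<bullet> h (x + u)\<bar>)"
      unfolding eq using h h' d by simp
    show "integrable lborel (\<lambda>x. ((norm (h x))\<^sup>2 + (norm (h (x + u)))\<^sup>2) / 2)"
      using h h' by simp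
    show "\<bar>h x \<bullet> h (x + u)\<bar> \<le> ((norm (h x))\<^sup>2 + (norm (h (x + u)))\<^sup>2) / 2" for x
      using Cauchy_Schwarz_ineq2[of "h x" "h (x + u)"] sum_squares_bound[of "norm (h x)" "norm (h (x + u))"]
      by simp
  qed
  also have "\<dots> = ?N" using h h' s by simp
  finally show "\<bar>autocorrelation h u\<bar> \<le> ?N" .
qed

lemma integral_lborel_scale:
  fixes f :: "'a::euclidean_space \<Rightarrow> real"
  assumes [measurable]: "f \<in> borel_measurable borel" and c: "c > 0"
  shows "(LINT x|lborel. f x) = c ^ DIM('a) * (LINT x|lborel. f (c *\<^sub>R x))"
  using c by (subst lborel_affine[of c 0]) (simp_all add: integral_density integral_distr)

text \<open>Rescaling u = e v fixes the kernel and moves the parameter into the argument of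
  \<open>A\<close>, so that dominated convergence applies with majorant
  \<open>gauss_kernel2 1 v * C\<close>.\<close>

lemma gauss_kernel2_limit:
  fixes A :: "real \<times> real \<Rightarrow> real"
  assumes [measurable]: "A \<in> borel_measurable borel" and bound: "\<And>u. \<bar>A u\<bar> \<le> C"
    and cont: "\<And>u. u \<longlonglongrightarrow> 0 \<Longrightarrow> (\<lambda>n. A (u n)) \<longlonglongrightarrow> A 0"
    and e: "\<And>n. e n > 0" "e \<longlonglongrightarrow> 0"
  shows "(\<lambda>n. LINT u|lborel. gauss_kernel2 (e n) u * A u) \<longlonglongrightarrow> A 0"
proof -
  have "has_bochner_integral lborel std_normal_density 1"
    using fourier_cos_std_normal_density[of 0] by simp
  from has_bochner_integral_mult_lborel[OF this this]
  have K: "has_bochner_integral lborel (gauss_kernel2 1) 1"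
    by (simp add: gauss_kernel2_def[abs_def] gauss_kernel_def)
  then have K_int: "integrable lborel (gauss_kernel2 1)" and "(LINT v|lborel. gauss_kernel2 1 v) = 1"
    by (auto simp: has_bochner_integral_iff)
  have "(LINT u|lborel. gauss_kernel2 (e n) u * A u) = (LINT v|lborel. gauss_kernel2 1 v * A (e n *\<^sub>R v))" for n
  proof -
    \<comment> \<open>The factor \<open>(e n)\<^sup>2\<close> cancels the Jacobian of the dilation
      of the plane.\<close>
    have "gauss_kernel2 (e n) (e n *\<^sub>R v) = gauss_kernel2 1 v / (e n)\<^sup>2" for v
      using e(1)[of n] by (simp add: gauss_kernel2_def gauss_kernel_def power2_eq_square)
    then show ?thesis
      using e(1)[of n] by (subst integral_lborel_scale[OF _ e(1)[of n]]) (simp_all add: power2_eq_square)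
  qed
  moreover have "(\<lambda>n. LINT v|lborel. gauss_kernel2 1 v * A (e n *\<^sub>R v)) \<longlonglongrightarrow> (LINT v|lborel. gauss_kernel2 1 v * A 0)"
  proof (rule integral_dominated_convergence)
    show "integrable lborel (\<lambda>v. gauss_kernel2 1 v * C)"
      using K_int by simp
    show "AE v in lborel. (\<lambda>n. gauss_kernel2 1 v * A (e n *\<^sub>R v)) \<longlonglongrightarrow> gauss_kernel2 1 v * A 0"
    proof (rule AE_I2)
      fix v :: "real \<times> real"
      have "(\<lambda>n. e n *\<^sub>R v) \<longlonglongrightarrow> 0 *\<^sub>R v" by (intro tendsto_intros e)
      then show "(\<lambda>n. gauss_kernel2 1 v * A (e n *\<^sub>R v)) \<longlonglongrightarrow> gauss_kernel2 1 v * A 0"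
        by (intro tendsto_intros cont) simp
    qed
    show "AE v in lborel. norm (gauss_kernel2 1 v * A (e n *\<^sub>R v)) \<le> gauss_kernel2 1 v * C" for n
      using bound gauss_kernel2_nonneg[of 1] by (intro AE_I2) (auto simp: abs_mult intro!: mult_left_mono)
  qed measurable
  ultimately show ?thesis
    using \<open>(LINT v|lborel. gauss_kernel2 1 v) = 1\<close> by simp
qed

text \<open>L^1 makes the transform an absolutely convergent integral; L^2 gives the continuity at 0
  of the autocorrelation. Monotone convergence removes the weights, and the limit of the weighted
  integrals is \<open>autocorrelation h 0\<close>.\<close>

theorem qft_plancherel:
  assumes h: "integrable lborel h" and h2: "integrable lborel (\<lambda>x. (norm (h x))\<^sup>2)"
  shows "has_bochner_integral lborel (\<lambda>w. (norm (qft h w))\<^sup>2) (LINT x|lborel. (norm (h x))\<^sup>2)"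
proof -
  have m [measurable]: "h \<in> borel_measurable borel"
    using borel_measurable_integrable[OF h] by simp
  define e :: "nat \<Rightarrow> real" where "e n = 1 / real (Suc n)" for n
  have e: "e n > 0" "e \<longlonglongrightarrow> 0" for n
    unfolding e_def using LIMSEQ_inverse_real_of_nat by (simp_all add: inverse_eq_divide)
  have G: "has_bochner_integral lborel (\<lambda>w. gauss_weight2 (e n) w * (norm (qft h w))\<^sup>2)
      (LINT u|lborel. gauss_kernel2 (e n) u * autocorrelation h u)" for n
    using gauss_parseval[OF e(1) h] gauss_kernel_autocorrelation[OF e(1) h] by simp
  have "(\<lambda>n. LINT u|lborel. gauss_kernel2 (e n) u * autocorrelation h u) \<longlonglongrightarrow> autocorrelation h 0"
  proof (rule gauss_kernel2_limit[OF _ abs_autocorrelation_le[OF m h2] _ e])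
    fix u :: "nat \<Rightarrow> real \<times> real" assume "u \<longlonglongrightarrow> 0"
    from tendsto_diff[OF tendsto_const tendsto_divide[OF translation_L2[OF m h2 this] tendsto_const]]
    show "(\<lambda>n. autocorrelation h (u n)) \<longlonglongrightarrow> autocorrelation h 0"
      unfolding autocorrelation_eq[OF m h2] by simp
  qed measurable
  then have lim: "(\<lambda>n. LINT w|lborel. gauss_weight2 (e n) w * (norm (qft h w))\<^sup>2) \<longlonglongrightarrow> (LINT x|lborel. (norm (h x))\<^sup>2)"
    using G by (simp add: has_bochner_integral_iff autocorrelation_eq[OF m h2])
  have mono: "mono (\<lambda>n. gauss_weight2 (e n) w * (norm (qft h w))\<^sup>2)" for w
  proof (intro monoI mult_right_mono)
    fix m n :: nat assume "m \<le> n"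
    then have "(e n)\<^sup>2 \<le> (e m)\<^sup>2" unfolding e_def by (intro power_mono) (auto simp: frac_le)
    then have "gauss_weight (e m) t \<le> gauss_weight (e n) t" for t
      by (auto simp: gauss_weight_def power_mult_distrib intro!: mult_mono)
    then show "gauss_weight2 (e m) w \<le> gauss_weight2 (e n) w"
      unfolding gauss_weight2_def by (intro mult_mono) (auto simp: gauss_weight_def)
  qed simp
  have pointwise: "(\<lambda>n. gauss_weight2 (e n) w * (norm (qft h w))\<^sup>2) \<longlonglongrightarrow> (norm (qft h w))\<^sup>2" for w
  proof -
    \<comment> \<open>The weight is continuous in its parameter, and
      \<open>gauss_weight2 0 w = 1\<close>.\<close>
    have "(\<lambda>n. gauss_weight2 (e n) w * (norm (qft h w))\<^sup>2) \<longlonglongrightarrow> gauss_weight2 0 w * (norm (qft h w))\<^sup>2"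
      unfolding gauss_weight2_def gauss_weight_def by (intro tendsto_intros e) auto
    then show ?thesis by (simp add: gauss_weight2_def gauss_weight_def)
  qed
  show ?thesis
  proof (rule has_bochner_integral_monotone_convergence)
    show "(\<lambda>w. (norm (qft h w))\<^sup>2) \<in> borel_measurable lborel"
      unfolding qft_def by measurable
    show "integrable lborel (\<lambda>w. gauss_weight2 (e n) w * (norm (qft h w))\<^sup>2)" for n
      using G by (simp add: has_bochner_integral_iff)
  qed (use mono pointwise lim in auto)
qed

subsection \<open>The Gabor transform\<close>

text \<open>Reduction to real coordinates; the basis is finite, so the exceptional null sets combine
  into one.\<close>

lemma completion_ex_borel_measurable_euclidean:
  fixes f :: "'a \<Rightarrow> 'b::euclidean_space"
  assumes f: "f \<in> borel_measurable (completion M)"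
  shows "\<exists>g\<in>borel_measurable M. AE x in M. f x = g x"
proof -
  have "\<exists>g. g \<in> borel_measurable M \<and> (AE x in M. f x \<bullet> b = g x)" for b
    using completion_ex_borel_measurable_real[of "\<lambda>x. f x \<bullet> b" M] f by auto
  then obtain g where g [measurable]: "\<And>b. g b \<in> borel_measurable M" and eq: "\<And>b. AE x in M. f x \<bullet> b = g b x"
    by metis
  have "AE x in M. \<forall>b\<in>Basis. f x \<bullet> b = g b x"
    by (rule AE_finite_allI) (simp_all add: eq)
  then have "AE x in M. f x = (\<Sum>b\<in>Basis. g b x *\<^sub>R b)"
    by eventually_elim (metis (no_types, lifting) euclidean_representation sum.cong)
  then show ?thesis
    by (intro bexI[of _ "\<lambda>x. \<Sum>b\<in>Basis. g b x *\<^sub>R b"]) measurable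
qed

lemma AE_lborel_shift:
  fixes t :: "'a::euclidean_space"
  assumes "AE x in lborel. P x"
  shows "AE x in lborel. P (x + t)"
  by (rule AE_distrD[of _ lborel lborel]) (simp, subst distr_lborel_shift, rule assms)

text \<open>The window is only Lebesgue measurable, so composing it with a shift requires preimages
  of Lebesgue sets to be Lebesgue sets.\<close>

lemma measurable_lebesgue_shift:
  "(\<lambda>x. x + t) \<in> lebesgue \<rightarrow>\<^sub>M (lebesgue :: 'a::euclidean_space measure)"
  using lebesgue_affine_measurable[of "\<lambda>_. 1" t] by (simp add: euclidean_representation add.commute)

lemma nn_integral_lborel_reflect:
  fixes g :: "'a::euclidean_space \<Rightarrow> ennreal"
  assumes [measurable]: "g \<in> borel_measurable borel"
  shows "(\<integral>\<^sup>+x. g (t - x) \<partial>lborel) = (\<integral>\<^sup>+x. g x \<partial>lborel)"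
  by (subst (2) lborel_affine[of "- 1" t]) (simp_all add: nn_integral_density nn_integral_distr)

lemma integral_Cauchy_Schwarz:
  fixes f g :: "'a \<Rightarrow> real"
  assumes [measurable]: "f \<in> borel_measurable M" "g \<in> borel_measurable M"
    and f: "integrable M (\<lambda>x. (f x)\<^sup>2)" and g: "integrable M (\<lambda>x. (g x)\<^sup>2)"
  shows "integrable M (\<lambda>x. f x * g x)"
    and "(LINT x|M. \<bar>f x * g x\<bar>) \<le> sqrt (LINT x|M. (f x)\<^sup>2) * sqrt (LINT x|M. (g x)\<^sup>2)"
proof -
  show i: "integrable M (\<lambda>x. f x * g x)"
  proof (rule Bochner_Integration.integrable_bound)
    show "integrable M (\<lambda>x. (f x)\<^sup>2 + (g x)\<^sup>2)" using f g by simp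
    show "AE x in M. norm (f x * g x) \<le> norm ((f x)\<^sup>2 + (g x)\<^sup>2)"
    proof (rule AE_I2)
      fix x
      have "2 * \<bar>f x\<bar> * \<bar>g x\<bar> \<le> (f x)\<^sup>2 + (g x)\<^sup>2"
        using sum_squares_bound[of "\<bar>f x\<bar>" "\<bar>g x\<bar>"] by simp
      moreover have "0 \<le> \<bar>f x\<bar> * \<bar>g x\<bar>" by simp
      ultimately show "norm (f x * g x) \<le> norm ((f x)\<^sup>2 + (g x)\<^sup>2)"
        unfolding real_norm_def abs_mult by linarith
    qed
  qed measurable
  \<comment> \<open>The inequality is taken from nonnegative integrals; integrability of all three
    integrands then turns them into real integrals.\<close>
  have "(\<integral>\<^sup>+x. ennreal \<bar>f x\<bar> * ennreal \<bar>g x\<bar> \<partial>M)\<^sup>2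
      \<le> (\<integral>\<^sup>+x. (ennreal \<bar>f x\<bar>)\<^sup>2 \<partial>M) * (\<integral>\<^sup>+x. (ennreal \<bar>g x\<bar>)\<^sup>2 \<partial>M)"
    by (rule Cauchy_Schwarz_nn_integral) measurable
  then have "(\<integral>\<^sup>+x. ennreal \<bar>f x * g x\<bar> \<partial>M)\<^sup>2 \<le> (\<integral>\<^sup>+x. (f x)\<^sup>2 \<partial>M) * (\<integral>\<^sup>+x. (g x)\<^sup>2 \<partial>M)"
    by (simp add: ennreal_mult[symmetric] abs_mult ennreal_power)
  moreover have "(\<integral>\<^sup>+x. ennreal \<bar>f x * g x\<bar> \<partial>M) = ennreal (LINT x|M. \<bar>f x * g x\<bar>)"
    using i by (intro nn_integral_eq_integral) auto
  moreover have "(\<integral>\<^sup>+x. (f x)\<^sup>2 \<partial>M) = ennreal (LINT x|M. (f x)\<^sup>2)" "(\<integral>\<^sup>+x. (g x)\<^sup>2 \<partial>M) = ennreal (LINT x|M. (g x)\<^sup>2)"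
    using f g by (auto intro: nn_integral_eq_integral)
  ultimately have "(LINT x|M. \<bar>f x * g x\<bar>)\<^sup>2 \<le> (LINT x|M. (f x)\<^sup>2) * (LINT x|M. (g x)\<^sup>2)"
    by (simp add: ennreal_power ennreal_mult[symmetric])
  then show "(LINT x|M. \<bar>f x * g x\<bar>) \<le> sqrt (LINT x|M. (f x)\<^sup>2) * sqrt (LINT x|M. (g x)\<^sup>2)"
    by (simp add: real_le_rsqrt real_sqrt_mult[symmetric])
qed

lemma borel_measurable_qcnj [measurable]: "qcnj \<in> borel_measurable borel"
proof -
  have "linear qcnj" by (rule linearI) (simp_all add: quat_eq_iff)
  then show ?thesis
    by (intro borel_measurable_continuous_onI linear_continuous_on) (rule linear_conv_bounded_linear[THEN iffD1])
qed

text \<open>With \<open>b\<close> fixed, this is the function of \<open>x\<close> whose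
  \<open>qft\<close> is the Gabor transform at translation \<open>b\<close>.\<close>

definition gabor_slice :: "(real \<times> real \<Rightarrow> quat) \<Rightarrow> (real \<times> real \<Rightarrow> quat) \<Rightarrow> real \<times> real \<Rightarrow> real \<times> real \<Rightarrow> quat" where
  "gabor_slice f \<phi> b x = f x * qcnj (\<phi> (x - b))"

lemma borel_measurable_gabor_slice [measurable (raw)]:
  assumes [measurable]: "f \<in> borel_measurable borel" "\<phi> \<in> borel_measurable borel"
    "u \<in> borel_measurable M" "v \<in> borel_measurable M"
  shows "(\<lambda>z. gabor_slice f \<phi> (u z) (v z)) \<in> borel_measurable M"
  unfolding gabor_slice_def by measurable

section \<open>Plancherel identity and uniform bound for Borel representatives\<close>

context
  fixes f \<phi> :: "real \<times> real \<Rightarrow> quat"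
  assumes f_meas [measurable]: "f \<in> borel_measurable borel" and phi_meas [measurable]: "\<phi> \<in> borel_measurable borel"
    and f_int: "integrable lborel (\<lambda>x. (norm (f x))\<^sup>2)" and phi_int: "integrable lborel (\<lambda>x. (norm (\<phi> x))\<^sup>2)"
begin

text \<open>Modulation preserves the norm, so Cauchy-Schwarz for \<open>f\<close> and the shifted
  window controls both the slice and its transform, uniformly in \<open>b\<close> and
  \<open>w\<close>.\<close>

lemma
  shows integrable_gabor_slice: "integrable lborel (gabor_slice f \<phi> b)"
    and norm_qft_gabor_slice_le: "norm (qft (gabor_slice f \<phi> b) w)
      \<le> sqrt (LINT x|lborel. (norm (f x))\<^sup>2) * sqrt (LINT x|lborel. (norm (\<phi> x))\<^sup>2)"
proof -
  have s: "integrable lborel (\<lambda>x. (norm (\<phi> (x - b)))\<^sup>2)"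
    "(LINT x|lborel. (norm (\<phi> (x - b)))\<^sup>2) = (LINT x|lborel. (norm (\<phi> x))\<^sup>2)"
    using integrable_lborel_shift[OF phi_int, of "- b"] integral_lborel_shift[of "\<lambda>x. (norm (\<phi> x))\<^sup>2" "- b"]
    by simp_all
  note CS = integral_Cauchy_Schwarz[of "\<lambda>x. norm (f x)" lborel "\<lambda>x. norm (\<phi> (x - b))", OF _ _ f_int s(1)]
  have n: "norm (gabor_slice f \<phi> b x) = norm (f x) * norm (\<phi> (x - b))" for x
    by (simp add: gabor_slice_def norm_mult)
  show i: "integrable lborel (gabor_slice f \<phi> b)"
    by (rule Bochner_Integration.integrable_bound[OF CS(1)]) (simp_all add: n)
  have "norm (qft (gabor_slice f \<phi> b) w) \<le> (LINT x|lborel. norm (gabor_slice f \<phi> b x))"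
    unfolding qft_def using integral_norm_bound[of lborel "\<lambda>x. qmod w x (gabor_slice f \<phi> b x)"] by simp
  also have "\<dots> \<le> sqrt (LINT x|lborel. (norm (f x))\<^sup>2) * sqrt (LINT x|lborel. (norm (\<phi> x))\<^sup>2)"
    using CS(2) by (simp add: n s(2))
  finally show "norm (qft (gabor_slice f \<phi> b) w)
      \<le> sqrt (LINT x|lborel. (norm (f x))\<^sup>2) * sqrt (LINT x|lborel. (norm (\<phi> x))\<^sup>2)" .
qed

text \<open>For almost every \<open>b\<close> the frequency integral is the squared L^2 norm of the
  slice, by \<open>qft_plancherel\<close>; Tonelli evaluates the integral of these norms over
  \<open>b\<close>.\<close>

theorem gabor_plancherel:
  "has_bochner_integral lborel (\<lambda>p. (norm (qft (gabor_slice f \<phi> (snd p)) (fst p)))\<^sup>2)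
    ((LINT x|lborel. (norm (f x))\<^sup>2) * (LINT x|lborel. (norm (\<phi> x))\<^sup>2))"
proof -
  let ?Q = "\<lambda>w b. (norm (qft (gabor_slice f \<phi> b) w))\<^sup>2"
  let ?F = "LINT x|lborel. (norm (f x))\<^sup>2" and ?P = "LINT x|lborel. (norm (\<phi> x))\<^sup>2"
  have [measurable]: "(\<lambda>p. ?Q (fst p) (snd p)) \<in> borel_measurable borel"
    unfolding qft_def by measurable
  have F: "(\<integral>\<^sup>+x. (norm (f x))\<^sup>2 \<partial>lborel) = ennreal ?F" and P: "(\<integral>\<^sup>+x. (norm (\<phi> x))\<^sup>2 \<partial>lborel) = ennreal ?P"
    using f_int phi_int by (auto intro: nn_integral_eq_integral)
  have sq: "ennreal ((norm (gabor_slice f \<phi> b x))\<^sup>2) = ennreal ((norm (f x))\<^sup>2) * ennreal ((norm (\<phi> (x - b)))\<^sup>2)" for b x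
    by (simp add: gabor_slice_def norm_mult power_mult_distrib ennreal_mult)
  have "(\<integral>\<^sup>+b. \<integral>\<^sup>+x. (norm (gabor_slice f \<phi> b x))\<^sup>2 \<partial>lborel \<partial>lborel) = (\<integral>\<^sup>+x. \<integral>\<^sup>+b. (norm (gabor_slice f \<phi> b x))\<^sup>2 \<partial>lborel \<partial>lborel)"
    by (rule lborel_pair.Fubini') (simp add: lborel_prod case_prod_beta')
  \<comment> \<open>For fixed \<open>x\<close> the reflection of \<open>b\<close> to
    \<open>x - b\<close> makes the inner integral independent of \<open>x\<close>.\<close>
  also have "\<dots> = (\<integral>\<^sup>+x. ennreal ((norm (f x))\<^sup>2) * ennreal ?P \<partial>lborel)"
    unfolding sq using nn_integral_lborel_reflect[of "\<lambda>x. ennreal ((norm (\<phi> x))\<^sup>2)"] by (simp add: nn_integral_cmult P)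
  also have "\<dots> = ennreal (?F * ?P)"
    by (simp add: nn_integral_multc F ennreal_mult)
  finally have tonelli: "(\<integral>\<^sup>+b. \<integral>\<^sup>+x. (norm (gabor_slice f \<phi> b x))\<^sup>2 \<partial>lborel \<partial>lborel) = ennreal (?F * ?P)" .
  \<comment> \<open>Finiteness of the iterated integral puts almost every slice in L^2, the second
    hypothesis of \<open>qft_plancherel\<close>.\<close>
  have "AE b in lborel. (\<integral>\<^sup>+x. (norm (gabor_slice f \<phi> b x))\<^sup>2 \<partial>lborel) \<noteq> \<infinity>"
    by (rule nn_integral_PInf_AE) (simp_all add: tonelli)
  then have slice: "AE b in lborel. (\<integral>\<^sup>+w. ?Q w b \<partial>lborel) = (\<integral>\<^sup>+x. (norm (gabor_slice f \<phi> b x))\<^sup>2 \<partial>lborel)"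
  proof eventually_elim
    case (elim b)
    then have i: "integrable lborel (\<lambda>x. (norm (gabor_slice f \<phi> b x))\<^sup>2)"
      by (intro integrableI_bounded) (simp_all add: top.not_eq_extremum)
    have "(\<integral>\<^sup>+w. ?Q w b \<partial>lborel) = ennreal (LINT w|lborel. ?Q w b)"
      using qft_plancherel[OF integrable_gabor_slice i]
      by (intro nn_integral_eq_integral) (auto simp: has_bochner_integral_iff)
    also have "\<dots> = ennreal (LINT x|lborel. (norm (gabor_slice f \<phi> b x))\<^sup>2)"
      using qft_plancherel[OF integrable_gabor_slice i] by (simp add: has_bochner_integral_iff)
    also have "\<dots> = (\<integral>\<^sup>+x. (norm (gabor_slice f \<phi> b x))\<^sup>2 \<partial>lborel)"
      using i by (intro nn_integral_eq_integral[symmetric]) auto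
    finally show ?case .
  qed
  have "(\<integral>\<^sup>+p. ?Q (fst p) (snd p) \<partial>lborel) = (\<integral>\<^sup>+p. ?Q (fst p) (snd p) \<partial>(lborel \<Otimes>\<^sub>M lborel))"
    by (simp add: lborel_prod)
  also have "\<dots> = (\<integral>\<^sup>+b. \<integral>\<^sup>+w. ?Q w b \<partial>lborel \<partial>lborel)"
    by (subst lborel_pair.nn_integral_snd[symmetric]) (simp_all add: lborel_prod)
  also have "\<dots> = (\<integral>\<^sup>+b. \<integral>\<^sup>+x. (norm (gabor_slice f \<phi> b x))\<^sup>2 \<partial>lborel \<partial>lborel)"
    by (rule nn_integral_cong_AE[OF slice])
  also note tonelli
  finally show ?thesis
    by (intro has_bochner_integral_nn_integral) simp_all
qed

end

section \<open>Transfer to Lebesgue measurable functions and the concentration estimate\<close>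

text \<open>A translate of a null set is null, so for each fixed \<open>w\<close> and
  \<open>b\<close> the two integrands agree almost everywhere in \<open>x\<close>. The transforms
  therefore agree at every point \<open>w\<close>, \<open>b\<close>, not merely at almost every
  one.\<close>

lemma GQFT_eq_qft:
  assumes [measurable]: "f \<in> borel_measurable lebesgue" "\<phi> \<in> borel_measurable lebesgue"
    and m [measurable]: "f' \<in> borel_measurable borel" "\<phi>' \<in> borel_measurable borel"
    and f: "AE x in lborel. f x = f' x" and \<phi>: "AE x in lborel. \<phi> x = \<phi>' x"
  shows "GQFT \<phi> f w b = qft (gabor_slice f' \<phi>' b) w"
proof -
  have [measurable]: "(\<lambda>x. \<phi> (x - b)) \<in> borel_measurable lebesgue"
    using measurable_compose[OF measurable_lebesgue_shift[of "- b"] assms(2)] by simp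
  have [measurable]: "(\<lambda>x. exp ((- (2 * pi * fst x * fst w)) *\<^sub>R quat_i)) \<in> borel_measurable lebesgue"
    "(\<lambda>x. exp ((- (2 * pi * snd x * snd w)) *\<^sub>R quat_j)) \<in> borel_measurable lebesgue"
    unfolding exp_quat_i exp_quat_j by (rule measurable_completion, simp)+
  have [measurable]: "qcnj \<in> borel_measurable borel"
    by (rule borel_measurable_qcnj)
  have lhs: "(\<lambda>x. exp ((- (2 * pi * fst x * fst w)) *\<^sub>R quat_i) * f x * qcnj (\<phi> (x - b)) *
      exp ((- (2 * pi * snd x * snd w)) *\<^sub>R quat_j)) \<in> borel_measurable lebesgue"
    by measurable
  have g: "(\<lambda>x. qmod w x (gabor_slice f' \<phi>' b x)) \<in> borel_measurable borel"
    by (intro borel_measurable_qmod borel_measurable_gabor_slice m) simp_all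
  have "AE x in lborel. \<phi> (x - b) = \<phi>' (x - b)"
    using AE_lborel_shift[OF \<phi>, of "- b"] by simp
  with f have "AE x in lborel. exp ((- (2 * pi * fst x * fst w)) *\<^sub>R quat_i) * f x * qcnj (\<phi> (x - b)) *
      exp ((- (2 * pi * snd x * snd w)) *\<^sub>R quat_j) = qmod w x (gabor_slice f' \<phi>' b x)"
    by eventually_elim (simp only: qmod_def gabor_slice_def mult.assoc)
  then have "GQFT \<phi> f w b = (LINT x|lebesgue. qmod w x (gabor_slice f' \<phi>' b x))"
    unfolding GQFT_def
    by (intro integral_cong_AE[OF lhs measurable_completion AE_completion]) (use g in simp_all)
  also have "\<dots> = qft (gabor_slice f' \<phi>' b) w"
    unfolding qft_def using g by (intro integral_completion) simp
  finally show ?thesis .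
qed

lemma L2_quat_borel_representative:
  assumes "f \<in> L2_quat"
  obtains g where "g \<in> borel_measurable borel" "AE x in lborel. f x = g x"
    "integrable lborel (\<lambda>x. (norm (g x))\<^sup>2)" "L2_norm_quat f = sqrt (LINT x|lborel. (norm (g x))\<^sup>2)"
proof -
  have [measurable]: "f \<in> borel_measurable lebesgue" and f: "integrable lebesgue (\<lambda>x. (norm (f x))\<^sup>2)"
    using assms by (auto simp: L2_quat_def)
  obtain g where "g \<in> borel_measurable lborel" and eq: "AE x in lborel. f x = g x"
    using completion_ex_borel_measurable_euclidean[of f lborel] by auto
  then have g [measurable]: "g \<in> borel_measurable borel" by simp
  have g' [measurable]: "(\<lambda>x. (norm (g x))\<^sup>2) \<in> borel_measurable lebesgue"
    by (rule measurable_completion) simp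
  have eq': "AE x in lebesgue. (norm (f x))\<^sup>2 = (norm (g x))\<^sup>2"
    using AE_completion[OF eq] by eventually_elim simp
  have "integrable lebesgue (\<lambda>x. (norm (g x))\<^sup>2)"
    using f integrable_cong_AE[OF _ g' eq'] by simp
  then have "integrable lborel (\<lambda>x. (norm (g x))\<^sup>2)"
    by (subst (asm) integrable_completion) simp_all
  moreover have "(LINT x|lebesgue. (norm (f x))\<^sup>2) = (LINT x|lborel. (norm (g x))\<^sup>2)"
    using integral_cong_AE[OF _ g' eq'] integral_completion[of "\<lambda>x. (norm (g x))\<^sup>2" lborel] by simp
  ultimately show ?thesis
    using that[OF g eq] by (simp add: L2_norm_quat_def)
qed

theorem theorem4p3:
  fixes \<Sigma> :: "((real \<times> real) \<times> (real \<times> real)) set"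
    and f \<phi> :: "real \<times> real \<Rightarrow> quat"
  assumes "\<Sigma> \<in> sets lebesgue"
    and "0 < emeasure lebesgue \<Sigma>"
    and "emeasure lebesgue \<Sigma> < 1"
    and "f \<in> L2_quat"
    and "\<phi> \<in> L2_quat"
  shows "L2_norm_quat f * L2_norm_quat \<phi>
    \<le> 1 / sqrt (1 - measure lebesgue \<Sigma>)
      * sqrt (LINT p:- \<Sigma>|lebesgue. (norm (GQFT \<phi> f (fst p) (snd p)))\<^sup>2)"
proof -
  obtain f' where f': "f' \<in> borel_measurable borel" "AE x in lborel. f x = f' x"
    "integrable lborel (\<lambda>x. (norm (f' x))\<^sup>2)" "L2_norm_quat f = sqrt (LINT x|lborel. (norm (f' x))\<^sup>2)"
    using L2_quat_borel_representative[OF assms(4)] .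
  obtain \<phi>' where \<phi>': "\<phi>' \<in> borel_measurable borel" "AE x in lborel. \<phi> x = \<phi>' x"
    "integrable lborel (\<lambda>x. (norm (\<phi>' x))\<^sup>2)" "L2_norm_quat \<phi> = sqrt (LINT x|lborel. (norm (\<phi>' x))\<^sup>2)"
    using L2_quat_borel_representative[OF assms(5)] .
  define g where "g p = (norm (GQFT \<phi> f (fst p) (snd p)))\<^sup>2" for p
  define C where "C = (LINT x|lborel. (norm (f' x))\<^sup>2) * (LINT x|lborel. (norm (\<phi>' x))\<^sup>2)"
  define m where "m = measure lebesgue \<Sigma>"
  have GQFT: "GQFT \<phi> f w b = qft (gabor_slice f' \<phi>' b) w" for w b
    using assms(4,5) f'(1,2) \<phi>'(1,2) by (intro GQFT_eq_qft) (auto simp: L2_quat_def)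
  have C: "C \<ge> 0" "L2_norm_quat f * L2_norm_quat \<phi> = sqrt C"
    by (simp_all add: C_def f'(4) \<phi>'(4) real_sqrt_mult)
  \<comment> \<open>By \<open>GQFT\<close>, \<open>g\<close> agrees everywhere with a Borel
    function, so its integral is the same for \<open>lborel\<close> and
    \<open>lebesgue\<close>.\<close>
  have "has_bochner_integral lborel g C"
    unfolding g_def GQFT C_def by (rule gabor_plancherel) (use f' \<phi>' in auto)
  then have g: "integrable lebesgue g" "(LINT p|lebesgue. g p) = C"
    by (auto simp: has_bochner_integral_iff integrable_completion integral_completion)
  have g_le: "g p \<le> C" for p
  proof -
    have "norm (GQFT \<phi> f (fst p) (snd p)) \<le> sqrt C"
      unfolding GQFT C_def real_sqrt_mult by (rule norm_qft_gabor_slice_le) (use f' \<phi>' in auto)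
    then have "(norm (GQFT \<phi> f (fst p) (snd p)))\<^sup>2 \<le> (sqrt C)\<^sup>2"
      by (intro power_mono) auto
    then show ?thesis using C(1) by (simp add: g_def)
  qed
  \<comment> \<open>Finiteness lets the extended-real bound on \<Sigma> be read as a bound on the
    real number \<open>m\<close>, and makes the constant \<open>C\<close> integrable over
    \<Sigma>.\<close>
  have fin: "emeasure lebesgue \<Sigma> < \<infinity>"
    using less_trans[OF assms(3) ennreal_one_less_top] by simp
  have m: "m < 1"
    using assms(3) fin unfolding m_def
    by (metis emeasure_eq_ennreal_measure ennreal_1 ennreal_less_iff infinity_ennreal_def less_irrefl measure_nonneg)
  have ind: "integrable lebesgue (\<lambda>p. indicat_real \<Sigma> p * C)"
    using assms(1) fin by (intro integrable_mult_left) (simp add: integrable_indicator_iff)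
  have ig: "integrable lebesgue (\<lambda>p. indicat_real \<Sigma> p * g p)"
    using integrable_mult_indicator[OF assms(1) g(1)] by simp
  have "C * (1 - m) = C - (LINT p|lebesgue. indicat_real \<Sigma> p * C)"
    using assms(1) by (simp add: m_def algebra_simps)
  also have "\<dots> \<le> C - (LINT p|lebesgue. indicat_real \<Sigma> p * g p)"
    using g_le by (intro diff_left_mono integral_mono ind ig mult_left_mono) auto
  also have "\<dots> = (LINT p|lebesgue. g p - indicat_real \<Sigma> p * g p)"
    using g ig by simp
  also have "\<dots> = (LINT p:- \<Sigma>|lebesgue. g p)"
    unfolding set_lebesgue_integral_def
    by (intro Bochner_Integration.integral_cong) (auto simp: indicator_def)
  finally have "sqrt C * sqrt (1 - m) \<le> sqrt (LINT p:- \<Sigma>|lebesgue. g p)"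
    by (simp flip: real_sqrt_mult)
  then show ?thesis
    using m unfolding C(2) g_def m_def by (simp add: field_simps)
qed

end
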